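(* Let $\mathcal{O}_0$ be a finite set of closed formulas of $\Omega$, let $\varphi$ be a closed formula of $\Omega$, let $\Gamma=\mathcal{O}_0\cup\{\varphi\}$, and let $\Delta_0$ be the set of all constants occurring in formulas of $\Gamma$. Then in the finite variation of the game, Proponent has a winning strategy starting from the position $\mathcal{C}_0=(\mathcal{O}_0,\{\varphi\},\Delta_0)$ if and only if $\mathcal{O}_0\vDash_{finFin}\varphi$.
   Context: Language: $\Omega$ is a first-order intuitionistic language with predicate symbols and constants but no function symbols; connectives $\to,\wedge,\vee,\bot$ and quantifiers $\forall,\exists$; $\neg A$ abbreviates $A\to\bot$. Kripke frames are partially ordered sets of worlds together with an individual domain $\Delta_w$ at each world $w$, monotone along the order (the domains are considered part of the frame); a Kripke model adds an interpretation of constants and a monotone interpretation of atomic formulas, with the usual intuitionistic forcing clauses. For a class $X$ of frames, $T\vDash_X\varphi$ means: for every Kripke model based on a frame in $X$, if every formula of $T$ is true at every world of the model, then $\varphi$ is true at every world. $Fin$ is the class of all finite Kripke frames (finitely many worlds); $finFin$ is the class of frames in $Fin$ all of whose individual domains are finite. The game. For a set of formulas $\Gamma$ and a set $\Delta$ of objects, $\mathcal{F}(\Gamma,\Delta)$ is the set of all formulas $P[c_1,\dots,c_n]$ where $P[x_1,\dots,x_n]$ is a subformula of some formula of $\Gamma$ whose free variables are among $x_1,\dots,x_n$ and $c_i\in\Delta$. A position is a triple $\mathcal{C}=(\mathcal{O},\mathcal{P},\Delta)$ with $\mathcal{O},\mathcal{P}\subseteq\mathcal{F}(\Gamma,\Delta)$,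 where $\Gamma$ is fixed at the start as $\mathcal{O}_0\cup\{\varphi\}$. Proponent moves by adding formulas of $\mathcal{F}(\Gamma,\Delta)$ to $\mathcal{P}$. Opponent moves by first extending $\Delta$ to some $\Delta'\supseteq\Delta$ (possibly $\Delta'=\Delta$; new elements may be arbitrary new objects) and then adding formulas of $\mathcal{F}(\Gamma,\Delta')$ to $\mathcal{O}$. In the finite variation of the game, $\Delta_0$ is finite and Opponent may add only finitely many new elements to $\Delta$ in a single move. Truth in a position, for formulas of $\mathcal{F}(\Gamma,\Delta)$: $\mathcal{C}\nVdash\bot$; for atomic $A[c_1,\dots,c_n]$, $\mathcal{C}\Vdash A[c_1,\dots,c_n]$ iff $A[c_1,\dots,c_n]\in\mathcal{O}$; for $\star\in\{\to,\wedge,\vee\}$, $\mathcal{C}\Vdash\psi\star\chi$ iff $\psi\star\chi\in\mathcal{O}\cup\mathcal{P}$ and $(\mathcal{C}\Vdash\psi)\star(\mathcal{C}\Vdash\chi)$ holds with $\star$ read classically; for $q\in\{\forall,\exists\}$, $\mathcal{C}\Vdash qxP[x]$ iff $qxP[x]\in\mathcal{O}\cup\mathcal{P}$ and for $q$ (read classically) $\alpha\in\Delta$, $\mathcal{C}\Vdash P[\alpha]$. A formula of $\mathcal{P}$ (resp. $\mathcal{O}$) false in the current position is a mistake of Proponent (resp. Opponent). If Opponent has no mistakes but Proponent has a mistake, Proponent must move; otherwise Opponent must move. If after a player's move that same player must move again, that player loses and the game ends. If the game continues infinitely, Proponent wins.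
   Formalization: Models need only interpret constants occurring in Γ, and individual domains may be empty; otherwise the claim fails for O_0 = ∅, φ = ∃x(Px→Px) when Ω has a constant (φ is valid, but Proponent loses from Δ_0 = ∅). *)

theory Defs
  imports Main "HOL-Library.Infinite_Typeclass"
begin

section \<open>Language\<close>

text \<open>
  The elements of type \<open>'o\<close> are the objects that may be named in formulas: the constants of the
  language as well as the objects that Opponent introduces in the course of a game.
\<close>

datatype 'o tm = Var nat | Obj 'o

datatype ('p, 'o) form =
    Bot
  | Atom 'p "'o tm list"
  | Imp "('p, 'o) form" "('p, 'o) form"
  | Conj "('p, 'o) form" "('p, 'o) form"
  | Disj "('p, 'o) form" "('p, 'o) form"
  | Forall nat "('p, 'o) form"
  | Exists nat "('p, 'o) form"

fun vars_tm :: "'o tm \<Rightarrow> nat set" where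
  "vars_tm (Var x) = {x}"
| "vars_tm (Obj c) = {}"

fun constants_tm :: "'o tm \<Rightarrow> 'o set" where
  "constants_tm (Var x) = {}"
| "constants_tm (Obj c) = {c}"

primrec fv :: "('p, 'o) form \<Rightarrow> nat set" where
  "fv Bot = {}"
| "fv (Atom p ts) = (\<Union>t\<in>set ts. vars_tm t)"
| "fv (Imp A B) = fv A \<union> fv B"
| "fv (Conj A B) = fv A \<union> fv B"
| "fv (Disj A B) = fv A \<union> fv B"
| "fv (Forall x A) = fv A - {x}"
| "fv (Exists x A) = fv A - {x}"

primrec constants :: "('p, 'o) form \<Rightarrow> 'o set" where
  "constants Bot = {}"
| "constants (Atom p ts) = (\<Union>t\<in>set ts. constants_tm t)"
| "constants (Imp A B) = constants A \<union> constants B"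
| "constants (Conj A B) = constants A \<union> constants B"
| "constants (Disj A B) = constants A \<union> constants B"
| "constants (Forall x A) = constants A"
| "constants (Exists x A) = constants A"

primrec wf_form :: "('p \<Rightarrow> nat) \<Rightarrow> ('p, 'o) form \<Rightarrow> bool" where
  "wf_form ar Bot \<longleftrightarrow> True"
| "wf_form ar (Atom p ts) \<longleftrightarrow> length ts = ar p"
| "wf_form ar (Imp A B) \<longleftrightarrow> wf_form ar A \<and> wf_form ar B"
| "wf_form ar (Conj A B) \<longleftrightarrow> wf_form ar A \<and> wf_form ar B"
| "wf_form ar (Disj A B) \<longleftrightarrow> wf_form ar A \<and> wf_form ar B"
| "wf_form ar (Forall x A) \<longleftrightarrow> wf_form ar A"
| "wf_form ar (Exists x A) \<longleftrightarrow> wf_form ar A"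

definition sentence :: "('p \<Rightarrow> nat) \<Rightarrow> ('p, 'o) form \<Rightarrow> bool" where
  "sentence ar A \<longleftrightarrow> wf_form ar A \<and> fv A = {}"

primrec subformulas :: "('p, 'o) form \<Rightarrow> ('p, 'o) form set" where
  "subformulas Bot = {Bot}"
| "subformulas (Atom p ts) = {Atom p ts}"
| "subformulas (Imp A B) = insert (Imp A B) (subformulas A \<union> subformulas B)"
| "subformulas (Conj A B) = insert (Conj A B) (subformulas A \<union> subformulas B)"
| "subformulas (Disj A B) = insert (Disj A B) (subformulas A \<union> subformulas B)"
| "subformulas (Forall x A) = insert (Forall x A) (subformulas A)"
| "subformulas (Exists x A) = insert (Exists x A) (subformulas A)"

text \<open>Objects contain no variables, so substituting them for free variables cannot cause capture.\<close>

fun inst_tm :: "(nat \<rightharpoonup> 'o) \<Rightarrow> 'o tm \<Rightarrow> 'o tm" where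
  "inst_tm s (Var x) = (case s x of None \<Rightarrow> Var x | Some c \<Rightarrow> Obj c)"
| "inst_tm s (Obj c) = Obj c"

primrec inst :: "(nat \<rightharpoonup> 'o) \<Rightarrow> ('p, 'o) form \<Rightarrow> ('p, 'o) form" where
  "inst s Bot = Bot"
| "inst s (Atom p ts) = Atom p (map (inst_tm s) ts)"
| "inst s (Imp A B) = Imp (inst s A) (inst s B)"
| "inst s (Conj A B) = Conj (inst s A) (inst s B)"
| "inst s (Disj A B) = Disj (inst s A) (inst s B)"
| "inst s (Forall x A) = Forall x (inst (s(x := None)) A)"
| "inst s (Exists x A) = Exists x (inst (s(x := None)) A)"


section \<open>Kripke semantics\<close>

record ('w, 'd) kframe =
  worlds :: "'w set"
  acc :: "('w \<times> 'w) set"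
  domain :: "'w \<Rightarrow> 'd set"

text \<open>Individual domains may be empty, just as the set of objects of a game position may be.\<close>

definition is_kframe :: "('w, 'd) kframe \<Rightarrow> bool" where
  "is_kframe F \<longleftrightarrow> partial_order_on (worlds F) (acc F) \<and>
     (\<forall>(w, v) \<in> acc F. domain F w \<subseteq> domain F v)"

definition Fin :: "('w, 'd) kframe set" where
  "Fin = {F. is_kframe F \<and> finite (worlds F)}"

definition finFin :: "('w, 'd) kframe set" where
  "finFin = {F \<in> Fin. \<forall>w\<in>worlds F. finite (domain F w)}"

record ('w, 'd, 'p, 'o) kmodel =
  frame :: "('w, 'd) kframe"
  constI :: "'o \<Rightarrow> 'd"
  atomI :: "'w \<Rightarrow> 'p \<Rightarrow> 'd list set"

text \<open>\<open>K\<close> is the set of constants to be interpreted.\<close>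

definition is_kmodel :: "'o set \<Rightarrow> ('w, 'd, 'p, 'o) kmodel \<Rightarrow> bool" where
  "is_kmodel K M \<longleftrightarrow> is_kframe (frame M) \<and>
     (\<forall>c\<in>K. \<forall>w\<in>worlds (frame M). constI M c \<in> domain (frame M) w) \<and>
     (\<forall>w\<in>worlds (frame M). \<forall>p. atomI M w p \<subseteq> lists (domain (frame M) w)) \<and>
     (\<forall>(w, v) \<in> acc (frame M). \<forall>p. atomI M w p \<subseteq> atomI M v p)"

fun val_tm :: "('w, 'd, 'p, 'o) kmodel \<Rightarrow> (nat \<Rightarrow> 'd) \<Rightarrow> 'o tm \<Rightarrow> 'd" where
  "val_tm M e (Var x) = e x"
| "val_tm M e (Obj c) = constI M c"

primrec forces :: "('w, 'd, 'p, 'o) kmodel \<Rightarrow> 'w \<Rightarrow> (nat \<Rightarrow> 'd) \<Rightarrow> ('p, 'o) form \<Rightarrow> bool" where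
  "forces M w e Bot \<longleftrightarrow> False"
| "forces M w e (Atom p ts) \<longleftrightarrow> map (val_tm M e) ts \<in> atomI M w p"
| "forces M w e (Imp A B) \<longleftrightarrow>
     (\<forall>v. (w, v) \<in> acc (frame M) \<longrightarrow> forces M v e A \<longrightarrow> forces M v e B)"
| "forces M w e (Conj A B) \<longleftrightarrow> forces M w e A \<and> forces M w e B"
| "forces M w e (Disj A B) \<longleftrightarrow> forces M w e A \<or> forces M w e B"
| "forces M w e (Forall x A) \<longleftrightarrow>
     (\<forall>v. (w, v) \<in> acc (frame M) \<longrightarrow> (\<forall>d\<in>domain (frame M) v. forces M v (e(x := d)) A))"
| "forces M w e (Exists x A) \<longleftrightarrow> (\<exists>d\<in>domain (frame M) w. forces M w (e(x := d)) A)"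

definition true_at :: "('w, 'd, 'p, 'o) kmodel \<Rightarrow> 'w \<Rightarrow> ('p, 'o) form \<Rightarrow> bool" where
  "true_at M w A \<longleftrightarrow> (\<forall>e. (\<forall>x\<in>fv A. e x \<in> domain (frame M) w) \<longrightarrow> forces M w e A)"

text \<open>
  The models considered interpret the constants that occur in \<open>T\<close> and \<open>A\<close>. Requiring an
  interpretation of further constants would only exclude models with empty domains.
\<close>

definition entails ::
  "('w, 'd) kframe set \<Rightarrow> ('p, 'o) form set \<Rightarrow> ('p, 'o) form \<Rightarrow> bool" where
  "entails X T A \<longleftrightarrow>
     (\<forall>M :: ('w, 'd, 'p, 'o) kmodel.
        is_kmodel (\<Union>B\<in>insert A T. constants B) M \<and> frame M \<in> X \<and>
        (\<forall>B\<in>T. \<forall>w\<in>worlds (frame M). true_at M w B) \<longrightarrow>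
        (\<forall>w\<in>worlds (frame M). true_at M w A))"


section \<open>The game\<close>

definition instances :: "('p, 'o) form set \<Rightarrow> 'o set \<Rightarrow> ('p, 'o) form set" where
  "instances \<Gamma> \<Delta> =
     {inst s A | s A. (\<exists>B\<in>\<Gamma>. A \<in> subformulas B) \<and> fv A \<subseteq> dom s \<and> ran s \<subseteq> \<Delta>}"

type_synonym ('p, 'o) position = "('p, 'o) form set \<times> ('p, 'o) form set \<times> 'o set"

primrec depth :: "('p, 'o) form \<Rightarrow> nat" where
  "depth Bot = 0"
| "depth (Atom p ts) = 0"
| "depth (Imp A B) = Suc (max (depth A) (depth B))"
| "depth (Conj A B) = Suc (max (depth A) (depth B))"
| "depth (Disj A B) = Suc (max (depth A) (depth B))"
| "depth (Forall x A) = Suc (depth A)"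
| "depth (Exists x A) = Suc (depth A)"

lemma depth_inst [simp]: "depth (inst s A) = depth A"
  by (induction A arbitrary: s) auto

function holds :: "('p, 'o) position \<Rightarrow> ('p, 'o) form \<Rightarrow> bool" where
  "holds (\<O>, \<P>, \<Delta>) Bot \<longleftrightarrow> False"
| "holds (\<O>, \<P>, \<Delta>) (Atom p ts) \<longleftrightarrow> Atom p ts \<in> \<O>"
| "holds (\<O>, \<P>, \<Delta>) (Imp A B) \<longleftrightarrow> Imp A B \<in> \<O> \<union> \<P> \<and>
     (holds (\<O>, \<P>, \<Delta>) A \<longrightarrow> holds (\<O>, \<P>, \<Delta>) B)"
| "holds (\<O>, \<P>, \<Delta>) (Conj A B) \<longleftrightarrow> Conj A B \<in> \<O> \<union> \<P> \<and>
     (holds (\<O>, \<P>, \<Delta>) A \<and> holds (\<O>, \<P>, \<Delta>) B)"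
| "holds (\<O>, \<P>, \<Delta>) (Disj A B) \<longleftrightarrow> Disj A B \<in> \<O> \<union> \<P> \<and>
     (holds (\<O>, \<P>, \<Delta>) A \<or> holds (\<O>, \<P>, \<Delta>) B)"
| "holds (\<O>, \<P>, \<Delta>) (Forall x A) \<longleftrightarrow> Forall x A \<in> \<O> \<union> \<P> \<and>
     (\<forall>a\<in>\<Delta>. holds (\<O>, \<P>, \<Delta>) (inst [x \<mapsto> a] A))"
| "holds (\<O>, \<P>, \<Delta>) (Exists x A) \<longleftrightarrow> Exists x A \<in> \<O> \<union> \<P> \<and>
     (\<exists>a\<in>\<Delta>. holds (\<O>, \<P>, \<Delta>) (inst [x \<mapsto> a] A))"
  by pat_completeness auto
termination
  by (relation "measure (\<lambda>(C, A). depth A)") auto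

datatype player = Proponent | Opponent

fun other :: "player \<Rightarrow> player" where
  "other Proponent = Opponent"
| "other Opponent = Proponent"

fun mistakes :: "player \<Rightarrow> ('p, 'o) position \<Rightarrow> ('p, 'o) form set" where
  "mistakes Proponent (\<O>, \<P>, \<Delta>) = {A \<in> \<P>. \<not> holds (\<O>, \<P>, \<Delta>) A}"
| "mistakes Opponent (\<O>, \<P>, \<Delta>) = {A \<in> \<O>. \<not> holds (\<O>, \<P>, \<Delta>) A}"

definition to_move :: "('p, 'o) position \<Rightarrow> player" where
  "to_move C = (if mistakes Opponent C = {} \<and> mistakes Proponent C \<noteq> {}
                then Proponent else Opponent)"

text \<open>Moves of the finite variation: Opponent adds finitely many objects at a time.\<close>

fun legal_move ::
  "('p, 'o) form set \<Rightarrow> player \<Rightarrow> ('p, 'o) position \<Rightarrow> ('p, 'o) position \<Rightarrow> bool" where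
  "legal_move \<Gamma> Proponent (\<O>, \<P>, \<Delta>) (\<O>', \<P>', \<Delta>') \<longleftrightarrow>
     \<O>' = \<O> \<and> \<Delta>' = \<Delta> \<and> (\<exists>X \<subseteq> instances \<Gamma> \<Delta>. \<P>' = \<P> \<union> X)"
| "legal_move \<Gamma> Opponent (\<O>, \<P>, \<Delta>) (\<O>', \<P>', \<Delta>') \<longleftrightarrow>
     \<P>' = \<P> \<and> \<Delta> \<subseteq> \<Delta>' \<and> finite (\<Delta>' - \<Delta>) \<and> (\<exists>X \<subseteq> instances \<Gamma> \<Delta>'. \<O>' = \<O> \<union> X)"

text \<open>
  A history is the nonempty list of positions reached so far. It is finished if the player who made
  the last move has to move again; no move is made after that.
\<close>

definition finished :: "('p, 'o) position list \<Rightarrow> bool" where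
  "finished h \<longleftrightarrow> length h \<ge> 2 \<and> to_move (last h) = to_move (last (butlast h))"

inductive history ::
  "('p, 'o) form set \<Rightarrow> ('p, 'o) position \<Rightarrow> ('p, 'o) position list \<Rightarrow> bool"
  for \<Gamma> C\<^sub>0 where
  start: "history \<Gamma> C\<^sub>0 [C\<^sub>0]"
| move: "history \<Gamma> C\<^sub>0 h \<Longrightarrow> \<not> finished h \<Longrightarrow> legal_move \<Gamma> (to_move (last h)) (last h) C \<Longrightarrow>
    history \<Gamma> C\<^sub>0 (h @ [C])"

datatype ('p, 'o) play =
    Finite "('p, 'o) position list"
  | Infinite "nat \<Rightarrow> ('p, 'o) position"

fun is_play :: "('p, 'o) form set \<Rightarrow> ('p, 'o) position \<Rightarrow> ('p, 'o) play \<Rightarrow> bool" where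
  "is_play \<Gamma> C\<^sub>0 (Finite h) \<longleftrightarrow> history \<Gamma> C\<^sub>0 h \<and> finished h"
| "is_play \<Gamma> C\<^sub>0 (Infinite f) \<longleftrightarrow> (\<forall>n. history \<Gamma> C\<^sub>0 (map f [0..<Suc n]))"

fun winner :: "('p, 'o) play \<Rightarrow> player" where
  "winner (Finite h) = other (to_move (last h))"
| "winner (Infinite f) = Proponent"

type_synonym ('p, 'o) strategy = "('p, 'o) position list \<Rightarrow> ('p, 'o) position"

definition follows :: "('p, 'o) strategy \<Rightarrow> player \<Rightarrow> ('p, 'o) position list \<Rightarrow> bool" where
  "follows \<sigma> pl h \<longleftrightarrow>
     (\<forall>i. Suc i < length h \<and> to_move (h ! i) = pl \<longrightarrow> h ! Suc i = \<sigma> (take (Suc i) h))"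

fun play_follows :: "('p, 'o) strategy \<Rightarrow> player \<Rightarrow> ('p, 'o) play \<Rightarrow> bool" where
  "play_follows \<sigma> pl (Finite h) \<longleftrightarrow> follows \<sigma> pl h"
| "play_follows \<sigma> pl (Infinite f) \<longleftrightarrow> (\<forall>n. follows \<sigma> pl (map f [0..<Suc n]))"

definition winning_strategy ::
  "('p, 'o) form set \<Rightarrow> ('p, 'o) position \<Rightarrow> player \<Rightarrow> ('p, 'o) strategy \<Rightarrow> bool" where
  "winning_strategy \<Gamma> C\<^sub>0 pl \<sigma> \<longleftrightarrow>
     (\<forall>h. history \<Gamma> C\<^sub>0 h \<and> \<not> finished h \<and> to_move (last h) = pl \<and> follows \<sigma> pl h \<longrightarrow>
        legal_move \<Gamma> pl (last h) (\<sigma> h)) \<and>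
     (\<forall>q. is_play \<Gamma> C\<^sub>0 q \<and> play_follows \<sigma> pl q \<longrightarrow> winner q = pl)"

end

theory Submission
  imports Defs
begin

text \<open>
  From a finite countermodel, Opponent wins by moving to a world \<open>w\<close> that is maximal among the worlds
  refuting some formula of \<open>\<P>\<close>, naming all individuals of \<open>w\<close> and asserting every instance
  forced at \<open>w\<close>. Truth in that position is forcing at \<open>w\<close>, so Proponent has to move, and he must
  make some formula of \<open>\<P>\<close> fail strictly above \<open>w\<close> in order not to lose at once.

  Conversely, Proponent wins by always asserting all instances that follow from \<open>\<O>\<close> over \<open>finFin\<close>.
  To see that he has no mistake if Opponent has none, refute each of the remaining instances,
  finitely many, in a finite model of \<open>\<O>\<close> and put these models above a new root with domain
  \<open>\<Delta>\<close> and atoms \<open>\<O>\<close>. Again truth in the position is forcing at the root, so the glued model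
  is a model of \<open>\<O>\<close> and hence of its consequences.
\<close>

section \<open>Instances of subformulas\<close>

lemma subformulas_refl: "A \<in> subformulas A"
  by (cases A) auto

lemma subformulas_trans: "A \<in> subformulas B \<Longrightarrow> subformulas A \<subseteq> subformulas B"
  by (induction B) auto

lemma finite_subformulas: "finite (subformulas A)"
  by (induction A) auto

lemma finite_fv: "finite (fv A)"
proof -
  have "finite (vars_tm t)" for t :: "'o tm"
    by (cases t) auto
  then show ?thesis
    by (induction A) auto
qed

lemma finite_constants: "finite (constants A)"
proof -
  have "finite (constants_tm t)" for t :: "'o tm"
    by (cases t) auto
  then show ?thesis
    by (induction A) auto
qed

lemma constants_subformulas: "A \<in> subformulas B \<Longrightarrow> constants A \<subseteq> constants B"
  by (induction B) auto

section \<open>Substitutions: congruence, composition, free variables and constants\<close>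

lemma inst_tm_cong: "(\<And>x. x \<in> vars_tm t \<Longrightarrow> s x = s' x) \<Longrightarrow> inst_tm s t = inst_tm s' t"
  by (cases t) auto

lemma inst_cong: "(\<And>x. x \<in> fv A \<Longrightarrow> s x = s' x) \<Longrightarrow> inst s A = inst s' A"
proof (induction A arbitrary: s s')
  case (Atom p ts)
  then show ?case by (auto intro!: inst_tm_cong)
next
  case (Imp A B)
  then show ?case by (metis UnI1 UnI2 fv.simps(3) inst.simps(3))
next
  case (Conj A B)
  then show ?case by (metis UnI1 UnI2 fv.simps(4) inst.simps(4))
next
  case (Disj A B)
  then show ?case by (metis UnI1 UnI2 fv.simps(5) inst.simps(5))
next
  case (Forall x A)
  have "inst (s(x := None)) A = inst (s'(x := None)) A"
    by (rule Forall.IH) (use Forall.prems in auto)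
  then show ?case by simp
next
  case (Exists x A)
  have "inst (s(x := None)) A = inst (s'(x := None)) A"
    by (rule Exists.IH) (use Exists.prems in auto)
  then show ?case by simp
qed simp

lemma inst_tm_empty: "inst_tm Map.empty t = t"
  by (cases t) auto

lemma inst_empty: "inst Map.empty A = A"
  by (induction A) (auto simp: inst_tm_empty map_idI)

lemma inst_tm_inst_tm: "inst_tm s (inst_tm r t) = inst_tm (s ++ r) t"
  by (cases t) (auto simp: map_add_def split: option.splits)

text \<open>The inner substitution \<open>r\<close> acts first and leaves no free variable of its
  domain for \<open>s\<close>. So \<open>r\<close> takes precedence, which is what the right
  argument of \<open>++\<close> does.\<close>

lemma inst_inst: "inst s (inst r A) = inst (s ++ r) A"
proof (induction A arbitrary: s r)
  case (Forall x A)
  have "s(x := None) ++ r(x := None) = (s ++ r)(x := None)"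
    by (auto simp: map_add_def fun_eq_iff split: option.splits)
  with Forall show ?case by (simp only: inst.simps)
next
  case (Exists x A)
  have "s(x := None) ++ r(x := None) = (s ++ r)(x := None)"
    by (auto simp: map_add_def fun_eq_iff split: option.splits)
  with Exists show ?case by (simp only: inst.simps)
qed (auto simp: inst_tm_inst_tm)

lemma vars_tm_inst_tm: "vars_tm (inst_tm s t) = vars_tm t - dom s"
  by (cases t) (auto split: option.splits)

lemma fv_inst: "fv (inst s A) = fv A - dom s"
  by (induction A arbitrary: s) (auto simp: vars_tm_inst_tm)

lemma constants_tm_inst_tm: "constants_tm (inst_tm s t) \<subseteq> constants_tm t \<union> ran s"
  by (cases t) (auto simp: ran_def split: option.splits)

lemma constants_inst: "constants (inst s A) \<subseteq> constants A \<union> ran s"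
proof (induction A arbitrary: s)
  case (Atom p ts)
  then show ?case using constants_tm_inst_tm[of s] by fastforce
next
  case (Forall x A)
  have "ran (s(x := None)) \<subseteq> ran s" by (auto simp: ran_def)
  with Forall[of "s(x := None)"] show ?case unfolding inst.simps constants.simps by blast
next
  case (Exists x A)
  have "ran (s(x := None)) \<subseteq> ran s" by (auto simp: ran_def)
  with Exists[of "s(x := None)"] show ?case unfolding inst.simps constants.simps by blast
qed (simp; blast)+

section \<open>The set of instances: finiteness and closure under immediate subformulas\<close>

lemma instancesI:
  "B \<in> \<Gamma> \<Longrightarrow> A \<in> subformulas B \<Longrightarrow> fv A \<subseteq> dom s \<Longrightarrow> ran s \<subseteq> \<Delta> \<Longrightarrow> inst s A \<in> instances \<Gamma> \<Delta>"
  unfolding instances_def by blast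

lemma instancesE:
  assumes "A \<in> instances \<Gamma> \<Delta>"
  obtains B A' s where "B \<in> \<Gamma>" "A' \<in> subformulas B" "fv A' \<subseteq> dom s" "ran s \<subseteq> \<Delta>" "A = inst s A'"
  using assms unfolding instances_def by blast

lemma instances_mono: "\<Delta> \<subseteq> \<Delta>' \<Longrightarrow> instances \<Gamma> \<Delta> \<subseteq> instances \<Gamma> \<Delta>'"
  unfolding instances_def by blast

lemma fv_instances: "A \<in> instances \<Gamma> \<Delta> \<Longrightarrow> fv A = {}"
  by (auto elim!: instancesE simp: fv_inst)

lemma constants_instances:
  assumes "A \<in> instances \<Gamma> \<Delta>" and "(\<Union>B\<in>\<Gamma>. constants B) \<subseteq> \<Delta>"
  shows "constants A \<subseteq> \<Delta>"
  using assms(1)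
proof (rule instancesE)
  fix B A' s
  assume "B \<in> \<Gamma>" "A' \<in> subformulas B" "ran s \<subseteq> \<Delta>" "A = inst s A'"
  then show ?thesis
    using assms(2) constants_subformulas[of A' B] constants_inst[of s A'] by blast
qed

lemma instances_if_closed: "A \<in> \<Gamma> \<Longrightarrow> fv A = {} \<Longrightarrow> A \<in> instances \<Gamma> \<Delta>"
  using instancesI[of A \<Gamma> A Map.empty \<Delta>] by (simp add: subformulas_refl inst_empty)

text \<open>A substitution matters only through its restriction to the free variables of the
  subformula, and there are finitely many maps from a finite set into \<open>\<Delta>\<close>. This
  bounds the number of countermodels that have to be glued together.\<close>

lemma finite_instances:
  assumes "finite \<Gamma>" and "finite \<Delta>"
  shows "finite (instances \<Gamma> \<Delta>)"
proof -
  let ?F = "\<Union>B\<in>\<Gamma>. \<Union>A\<in>subformulas B. (\<lambda>s. inst s A) ` {s. dom s = fv A \<and> ran s \<subseteq> \<Delta>}"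
  have "instances \<Gamma> \<Delta> \<subseteq> ?F"
  proof
    fix A assume "A \<in> instances \<Gamma> \<Delta>"
    then obtain B A' s where *: "B \<in> \<Gamma>" "A' \<in> subformulas B" "fv A' \<subseteq> dom s" "ran s \<subseteq> \<Delta>"
      and A: "A = inst s A'"
      by (rule instancesE)
    have "A = inst (s |` fv A') A'"
      unfolding A by (rule inst_cong) simp
    moreover have "dom (s |` fv A') = fv A'" "ran (s |` fv A') \<subseteq> \<Delta>"
      using * by (auto simp: ran_def restrict_map_def split: if_splits)
    ultimately show "A \<in> ?F" using * by blast
  qed
  moreover have "finite ?F"
    using assms by (auto simp: finite_subformulas finite_fv intro!: finite_set_of_finite_maps)
  ultimately show ?thesis by (rule finite_subset)
qed

lemma instances_ImpD: "Imp A B \<in> instances \<Gamma> \<Delta> \<Longrightarrow> A \<in> instances \<Gamma> \<Delta> \<and> B \<in> instances \<Gamma> \<Delta>"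
proof (erule instancesE)
  fix C D s
  assume *: "C \<in> \<Gamma>" "D \<in> subformulas C" "fv D \<subseteq> dom s" "ran s \<subseteq> \<Delta>" "Imp A B = inst s D"
  then obtain A' B' where "D = Imp A' B'" "A = inst s A'" "B = inst s B'"
    by (cases D) auto
  with * subformulas_trans[of D C] show ?thesis
    by (auto intro!: instancesI simp: subformulas_refl subset_iff)
qed

lemma instances_ConjD: "Conj A B \<in> instances \<Gamma> \<Delta> \<Longrightarrow> A \<in> instances \<Gamma> \<Delta> \<and> B \<in> instances \<Gamma> \<Delta>"
proof (erule instancesE)
  fix C D s
  assume *: "C \<in> \<Gamma>" "D \<in> subformulas C" "fv D \<subseteq> dom s" "ran s \<subseteq> \<Delta>" "Conj A B = inst s D"
  then obtain A' B' where "D = Conj A' B'" "A = inst s A'" "B = inst s B'"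
    by (cases D) auto
  with * subformulas_trans[of D C] show ?thesis
    by (auto intro!: instancesI simp: subformulas_refl subset_iff)
qed

lemma instances_DisjD: "Disj A B \<in> instances \<Gamma> \<Delta> \<Longrightarrow> A \<in> instances \<Gamma> \<Delta> \<and> B \<in> instances \<Gamma> \<Delta>"
proof (erule instancesE)
  fix C D s
  assume *: "C \<in> \<Gamma>" "D \<in> subformulas C" "fv D \<subseteq> dom s" "ran s \<subseteq> \<Delta>" "Disj A B = inst s D"
  then obtain A' B' where "D = Disj A' B'" "A = inst s A'" "B = inst s B'"
    by (cases D) auto
  with * subformulas_trans[of D C] show ?thesis
    by (auto intro!: instancesI simp: subformulas_refl subset_iff)
qed

text \<open>Common core of the two quantifier cases below. The body of a quantified instance comes
  from \<open>s\<close> with \<open>x\<close> removed; putting \<open>a\<close> for \<open>x\<close>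
  afterwards amounts to the single substitution that extends \<open>s\<close> by
  \<open>x \<mapsto> a\<close>.\<close>

lemma inst_upd_instances:
  assumes "B \<in> \<Gamma>" "D \<in> subformulas B" "A \<in> subformulas D" "fv A - {x} \<subseteq> dom s" "ran s \<subseteq> \<Delta>" "a \<in> \<Delta>"
  shows "inst [x \<mapsto> a] (inst (s(x := None)) A) \<in> instances \<Gamma> \<Delta>"
proof -
  have "[x \<mapsto> a] ++ s(x := None) = s(x \<mapsto> a)"
    by (auto simp: map_add_def split: option.splits)
  moreover have "A \<in> subformulas B"
    using assms(2,3) subformulas_trans by blast
  moreover have "ran (s(x \<mapsto> a)) \<subseteq> \<Delta>"
    using assms(5,6) by (auto simp: ran_def)
  ultimately show ?thesis
    using assms(1,4) by (auto simp: inst_inst intro!: instancesI)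
qed

lemma instances_ForallD:
  "Forall x A \<in> instances \<Gamma> \<Delta> \<Longrightarrow> a \<in> \<Delta> \<Longrightarrow> inst [x \<mapsto> a] A \<in> instances \<Gamma> \<Delta>"
proof (erule instancesE)
  fix B D s
  assume *: "a \<in> \<Delta>" "B \<in> \<Gamma>" "D \<in> subformulas B" "fv D \<subseteq> dom s" "ran s \<subseteq> \<Delta>" "Forall x A = inst s D"
  then obtain A' where "D = Forall x A'" "A = inst (s(x := None)) A'"
    by (cases D) auto
  with * show ?thesis
    using inst_upd_instances[of B \<Gamma> D A' x s \<Delta> a] by (simp add: subformulas_refl)
qed

lemma instances_ExistsD:
  "Exists x A \<in> instances \<Gamma> \<Delta> \<Longrightarrow> a \<in> \<Delta> \<Longrightarrow> inst [x \<mapsto> a] A \<in> instances \<Gamma> \<Delta>"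
proof (erule instancesE)
  fix B D s
  assume *: "a \<in> \<Delta>" "B \<in> \<Gamma>" "D \<in> subformulas B" "fv D \<subseteq> dom s" "ran s \<subseteq> \<Delta>" "Exists x A = inst s D"
  then obtain A' where "D = Exists x A'" "A = inst (s(x := None)) A'"
    by (cases D) auto
  with * show ?thesis
    using inst_upd_instances[of B \<Gamma> D A' x s \<Delta> a] by (simp add: subformulas_refl)
qed

lemma closed_terms_objects:
  assumes "fv (Atom p ts) = {}"
  obtains cs where "ts = map Obj cs"
proof -
  have "\<exists>c. t = Obj c" if "t \<in> set ts" for t
    using assms that by (cases t) auto
  then have "ts = map Obj (map (\<lambda>t. SOME c. t = Obj c) ts)"
    by (force intro!: map_idI[symmetric])
  then show ?thesis using that by blast
qed


section \<open>Forcing\<close>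

lemma is_kframe_acc:
  assumes "is_kframe F"
  shows is_kframe_refl: "w \<in> worlds F \<Longrightarrow> (w, w) \<in> acc F"
    and is_kframe_trans: "(u, v) \<in> acc F \<Longrightarrow> (v, w) \<in> acc F \<Longrightarrow> (u, w) \<in> acc F"
    and is_kframe_antisym: "(w, v) \<in> acc F \<Longrightarrow> (v, w) \<in> acc F \<Longrightarrow> w = v"
    and is_kframe_worlds: "(w, v) \<in> acc F \<Longrightarrow> w \<in> worlds F \<and> v \<in> worlds F"
    and is_kframe_domain: "(w, v) \<in> acc F \<Longrightarrow> domain F w \<subseteq> domain F v"
  using assms unfolding is_kframe_def partial_order_on_def preorder_on_def refl_on_def
  by (auto dest: transD antisymD)

lemma is_kmodel_frame: "is_kmodel K M \<Longrightarrow> is_kframe (frame M)"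
  by (simp add: is_kmodel_def)

lemma is_kmodelI:
  assumes "is_kframe (frame M)"
    and "\<And>c w. c \<in> K \<Longrightarrow> w \<in> worlds (frame M) \<Longrightarrow> constI M c \<in> domain (frame M) w"
    and "\<And>w p ds. w \<in> worlds (frame M) \<Longrightarrow> ds \<in> atomI M w p \<Longrightarrow> set ds \<subseteq> domain (frame M) w"
    and "\<And>w v p ds. (w, v) \<in> acc (frame M) \<Longrightarrow> ds \<in> atomI M w p \<Longrightarrow> ds \<in> atomI M v p"
  shows "is_kmodel K M"
  using assms unfolding is_kmodel_def by blast

lemma is_kmodel_const:
  "is_kmodel K M \<Longrightarrow> c \<in> K \<Longrightarrow> w \<in> worlds (frame M) \<Longrightarrow> constI M c \<in> domain (frame M) w"
  by (simp add: is_kmodel_def)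

lemma is_kmodel_atom_domain:
  "is_kmodel K M \<Longrightarrow> w \<in> worlds (frame M) \<Longrightarrow> ds \<in> atomI M w p \<Longrightarrow> set ds \<subseteq> domain (frame M) w"
  unfolding is_kmodel_def by blast

lemma is_kmodel_atom_mono:
  "is_kmodel K M \<Longrightarrow> (w, v) \<in> acc (frame M) \<Longrightarrow> atomI M w p \<subseteq> atomI M v p"
  by (fastforce simp: is_kmodel_def)

lemma is_kmodel_antimono: "is_kmodel K M \<Longrightarrow> K' \<subseteq> K \<Longrightarrow> is_kmodel K' M"
  by (auto simp: is_kmodel_def)

text \<open>Allows objects outside the current position to be reinterpreted as names of further
  individuals without affecting the formulas already in play.\<close>

lemma forces_cong:
  assumes "\<And>x. x \<in> fv A \<Longrightarrow> e x = e' x" and "\<And>c. c \<in> constants A \<Longrightarrow> constI M c = g c"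
  shows "forces M w e A \<longleftrightarrow> forces (M\<lparr>constI := g\<rparr>) w e' A"
  using assms
proof (induction A arbitrary: w e e')
  case (Atom p ts)
  have "val_tm M e t = val_tm (M\<lparr>constI := g\<rparr>) e' t" if "t \<in> set ts" for t
  proof (cases t)
    case (Var x)
    then show ?thesis using that Atom.prems(1)[of x] by force
  next
    case (Obj c)
    then show ?thesis using that Atom.prems(2)[of c] by force
  qed
  then have "map (val_tm M e) ts = map (val_tm (M\<lparr>constI := g\<rparr>) e') ts"
    by (rule map_cong[OF refl])
  then have "forces M w e (Atom p ts) \<longleftrightarrow> map (val_tm (M\<lparr>constI := g\<rparr>) e') ts \<in> atomI M w p"
    by (simp only: forces.simps)
  then show ?case by simp
next
  case (Imp A B)
  have "forces M v e A = forces (M\<lparr>constI := g\<rparr>) v e' A"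
    "forces M v e B = forces (M\<lparr>constI := g\<rparr>) v e' B" for v
    using Imp by auto
  then show ?case by simp
next
  case (Conj A B)
  have "forces M v e A = forces (M\<lparr>constI := g\<rparr>) v e' A"
    "forces M v e B = forces (M\<lparr>constI := g\<rparr>) v e' B" for v
    using Conj by auto
  then show ?case by simp
next
  case (Disj A B)
  have "forces M v e A = forces (M\<lparr>constI := g\<rparr>) v e' A"
    "forces M v e B = forces (M\<lparr>constI := g\<rparr>) v e' B" for v
    using Disj by auto
  then show ?case by simp
next
  case (Forall x A)
  have "forces M v (e(x := d)) A = forces (M\<lparr>constI := g\<rparr>) v (e'(x := d)) A" for v d
    by (rule Forall.IH) (use Forall.prems in auto)
  then show ?case by simp
next
  case (Exists x A)
  have "forces M v (e(x := d)) A = forces (M\<lparr>constI := g\<rparr>) v (e'(x := d)) A" for v d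
    by (rule Exists.IH) (use Exists.prems in auto)
  then show ?case by simp
qed simp

lemma forces_closed: "fv A = {} \<Longrightarrow> forces M w e A \<longleftrightarrow> forces M w e' A"
  using forces_cong[of A e e' M "constI M"] by simp

text \<open>For a closed formula the domain condition on environments is vacuous, so any single
  \<open>e\<close> decides truth, even at a world with empty domain.\<close>

lemma true_at_closed: "fv A = {} \<Longrightarrow> true_at M w A \<longleftrightarrow> forces M w e A"
  unfolding true_at_def using forces_closed by fastforce

lemma val_tm_inst_tm:
  "val_tm M e (inst_tm s t) =
     val_tm M (\<lambda>x. case s x of None \<Rightarrow> e x | Some c \<Rightarrow> constI M c) t"
  by (cases t) (auto split: option.splits)

lemma forces_inst:
  "forces M w e (inst s A) \<longleftrightarrow>
     forces M w (\<lambda>x. case s x of None \<Rightarrow> e x | Some c \<Rightarrow> constI M c) A"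
proof (induction A arbitrary: w e s)
  case (Atom p ts)
  then show ?case by (simp add: val_tm_inst_tm comp_def)
next
  case (Forall x A)
  have "(\<lambda>y. case (s(x := None)) y of None \<Rightarrow> (e(x := d)) y | Some c \<Rightarrow> constI M c) =
    (\<lambda>y. case s y of None \<Rightarrow> e y | Some c \<Rightarrow> constI M c)(x := d)" for d
    by (auto simp: fun_eq_iff split: option.splits)
  with Forall show ?case by (simp only: inst.simps forces.simps)
next
  case (Exists x A)
  have "(\<lambda>y. case (s(x := None)) y of None \<Rightarrow> (e(x := d)) y | Some c \<Rightarrow> constI M c) =
    (\<lambda>y. case s y of None \<Rightarrow> e y | Some c \<Rightarrow> constI M c)(x := d)" for d
    by (auto simp: fun_eq_iff split: option.splits)
  with Exists show ?case by (simp only: inst.simps forces.simps)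
qed simp_all

lemma forces_inst_single: "forces M w e (inst [x \<mapsto> a] A) \<longleftrightarrow> forces M w (e(x := constI M a)) A"
proof -
  have "(\<lambda>y. case [x \<mapsto> a] y of None \<Rightarrow> e y | Some c \<Rightarrow> constI M c) = e(x := constI M a)"
    by auto
  then show ?thesis by (simp only: forces_inst)
qed

lemma forces_mono:
  assumes "is_kmodel K M" and "(w, v) \<in> acc (frame M)" and "forces M w e A"
  shows "forces M v e A"
  using assms(2,3)
proof (induction A arbitrary: w v e)
  case (Atom p ts)
  then show ?case using is_kmodel_atom_mono[OF assms(1)] by auto
next
  case (Imp A B)
  then show ?case
    using is_kframe_trans[OF is_kmodel_frame[OF assms(1)] Imp.prems(1)] unfolding forces.simps by blast
next
  case (Forall x A)
  then show ?case
    using is_kframe_trans[OF is_kmodel_frame[OF assms(1)] Forall.prems(1)] unfolding forces.simps by blast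
next
  case (Exists x A)
  then show ?case
    using is_kframe_domain[OF is_kmodel_frame[OF assms(1)] Exists.prems(1)] unfolding forces.simps by blast
qed auto

text \<open>
  \<open>h\<close> need not be injective since the language has no equality; so objects that countermodels
  identify can be kept apart at the root below them.
\<close>

lemma forces_bounded_morphism:
  assumes forth: "\<And>w v. w \<in> U \<Longrightarrow> (w, v) \<in> acc (frame M) \<Longrightarrow> v \<in> U \<and> (f w, f v) \<in> acc (frame N)"
    and lift: "\<And>w v'. w \<in> U \<Longrightarrow> (f w, v') \<in> acc (frame N) \<Longrightarrow> \<exists>v. (w, v) \<in> acc (frame M) \<and> f v = v'"
    and dom: "\<And>w. w \<in> U \<Longrightarrow> h ` domain (frame M) w = domain (frame N) (f w)"
    and mono: "\<And>w v. w \<in> U \<Longrightarrow> (w, v) \<in> acc (frame M) \<Longrightarrow> domain (frame M) w \<subseteq> domain (frame M) v"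
    and atoms: "\<And>w p ds. w \<in> U \<Longrightarrow> set ds \<subseteq> domain (frame M) w \<Longrightarrow>
      ds \<in> atomI M w p \<longleftrightarrow> map h ds \<in> atomI N (f w) p"
    and const: "\<And>c. c \<in> K \<Longrightarrow> h (constI M c) = constI N c"
    and const_dom: "\<And>c w. c \<in> K \<Longrightarrow> w \<in> U \<Longrightarrow> constI M c \<in> domain (frame M) w"
    and "w \<in> U" and "constants A \<subseteq> K" and "\<And>x. x \<in> fv A \<Longrightarrow> e x \<in> domain (frame M) w"
  shows "forces M w e A \<longleftrightarrow> forces N (f w) (h \<circ> e) A"
  using assms(8-10)
proof (induction A arbitrary: w e)
  case (Atom p ts)
  have "h (val_tm M e t) = val_tm N (h \<circ> e) t \<and> val_tm M e t \<in> domain (frame M) w"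
    if "t \<in> set ts" for t
  proof (cases t)
    case (Var x)
    then show ?thesis using that Atom.prems(3) by force
  next
    case (Obj c)
    then have "c \<in> K" using that Atom.prems(2) by force
    with Obj show ?thesis using const const_dom[OF _ Atom.prems(1)] by simp
  qed
  then have "map h (map (val_tm M e) ts) = map (val_tm N (h \<circ> e)) ts"
    "set (map (val_tm M e) ts) \<subseteq> domain (frame M) w"
    by auto
  with atoms[OF Atom.prems(1), of "map (val_tm M e) ts" p] show ?case
    by (simp only: forces.simps)
next
  case (Imp A B)
  have *: "forces M v e A \<longleftrightarrow> forces N (f v) (h \<circ> e) A" "forces M v e B \<longleftrightarrow> forces N (f v) (h \<circ> e) B"
    if "(w, v) \<in> acc (frame M)" for v
    using forth[OF Imp.prems(1) that] mono[OF Imp.prems(1) that] Imp.prems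
    by (intro Imp.IH; auto)+
  \<comment> \<open>By \<open>forth\<close> and \<open>lift\<close> the worlds above
    \<open>f w\<close> are exactly the images of the worlds above \<open>w\<close>.\<close>
  have "forces N (f w) (h \<circ> e) (Imp A B) \<longleftrightarrow>
    (\<forall>v. (w, v) \<in> acc (frame M) \<longrightarrow> forces N (f v) (h \<circ> e) A \<longrightarrow> forces N (f v) (h \<circ> e) B)"
    using forth[OF Imp.prems(1)] lift[OF Imp.prems(1)] by (auto; blast)
  also have "\<dots> \<longleftrightarrow> forces M w e (Imp A B)"
    using * by simp
  finally show ?case ..
next
  case (Forall x A)
  have *: "forces M v (e(x := d)) A \<longleftrightarrow> forces N (f v) ((h \<circ> e)(x := h d)) A"
    if "(w, v) \<in> acc (frame M)" "d \<in> domain (frame M) v" for v d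
  proof -
    have "forces M v (e(x := d)) A \<longleftrightarrow> forces N (f v) (h \<circ> e(x := d)) A"
      using forth[OF Forall.prems(1) that(1)] mono[OF Forall.prems(1) that(1)] that Forall.prems
      by (intro Forall.IH) auto
    then show ?thesis by (simp add: fun_upd_comp)
  qed
  have **: "domain (frame N) (f v) = h ` domain (frame M) v" if "(w, v) \<in> acc (frame M)" for v
    using forth[OF Forall.prems(1) that] dom by auto
  \<comment> \<open>The worlds are replaced first, as for implication; \<open>**\<close> then turns
    the range of \<open>d'\<close> into the image under \<open>h\<close> of a domain of
    \<open>M\<close>.\<close>
  have "forces N (f w) (h \<circ> e) (Forall x A) \<longleftrightarrow>
    (\<forall>v. (w, v) \<in> acc (frame M) \<longrightarrow> (\<forall>d'\<in>domain (frame N) (f v). forces N (f v) ((h \<circ> e)(x := d')) A))"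
    using forth[OF Forall.prems(1)] lift[OF Forall.prems(1)] by (auto; blast)
  also have "\<dots> \<longleftrightarrow> forces M w e (Forall x A)"
    using * ** by simp
  finally show ?case ..
next
  case (Conj A B)
  have "forces M w e A \<longleftrightarrow> forces N (f w) (h \<circ> e) A" "forces M w e B \<longleftrightarrow> forces N (f w) (h \<circ> e) B"
    using Conj.prems by (intro Conj.IH; simp)+
  then show ?case by (simp only: forces.simps)
next
  case (Disj A B)
  have "forces M w e A \<longleftrightarrow> forces N (f w) (h \<circ> e) A" "forces M w e B \<longleftrightarrow> forces N (f w) (h \<circ> e) B"
    using Disj.prems by (intro Disj.IH; simp)+
  then show ?case by (simp only: forces.simps)
next
  case (Exists x A)
  have "forces M w (e(x := d)) A \<longleftrightarrow> forces N (f w) ((h \<circ> e)(x := h d)) A"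
    if "d \<in> domain (frame M) w" for d
  proof -
    have "forces M w (e(x := d)) A \<longleftrightarrow> forces N (f w) (h \<circ> e(x := d)) A"
      using that Exists.prems by (intro Exists.IH) auto
    then show ?thesis by (simp add: fun_upd_comp)
  qed
  then show ?case
    unfolding forces.simps dom[OF Exists.prems(1), symmetric] by blast
qed simp


section \<open>Consequence over a set of constants\<close>

text \<open>The interpreted constants are a parameter because the game needs consequence over all
  objects of \<open>\<Delta>\<close>, including those that occur in no asserted formula: each of
  them has to denote an individual in every domain.\<close>

definition entails_over ::
  "('w, 'd) kframe set \<Rightarrow> 'o set \<Rightarrow> ('p, 'o) form set \<Rightarrow> ('p, 'o) form \<Rightarrow> bool" where
  "entails_over X K T A \<longleftrightarrow>
     (\<forall>M :: ('w, 'd, 'p, 'o) kmodel.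
        is_kmodel K M \<and> frame M \<in> X \<and> (\<forall>B\<in>T. \<forall>w\<in>worlds (frame M). true_at M w B) \<longrightarrow>
        (\<forall>w\<in>worlds (frame M). true_at M w A))"

lemma entails_iff_entails_over: "entails X T A \<longleftrightarrow> entails_over X (\<Union>B\<in>insert A T. constants B) T A"
  by (simp add: entails_def entails_over_def)

text \<open>Models for the larger sets are models for the smaller ones. Hence what Proponent has
  asserted stays a consequence when Opponent enlarges \<open>\<Delta>\<close> and
  \<open>\<O>\<close>.\<close>

lemma entails_over_mono:
  assumes "entails_over X K T A" and "K \<subseteq> K'" and "T \<subseteq> T'"
  shows "entails_over X K' T' A"
  using assms is_kmodel_antimono unfolding entails_over_def by (metis subsetD)

lemma entails_over_refl: "A \<in> T \<Longrightarrow> entails_over X K T A"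
  by (simp add: entails_over_def)

text \<open>A finite model with finite domains can be copied along injections into any infinite
  types. So consequence over \<open>finFin\<close> at the given types also speaks about the glued
  model, whose worlds and individuals are built from options, pairs and sums.\<close>

lemma finFin_model_transfer:
  fixes N :: "('v, 'c, 'p, 'o) kmodel"
  assumes N: "is_kmodel K N" and fin: "frame N \<in> finFin"
  obtains M :: "('w::infinite, 'd::infinite, 'p, 'o) kmodel" and i
  where "is_kmodel K M" and "frame M \<in> finFin" and "worlds (frame M) = i ` worlds (frame N)"
    and "\<And>w A. w \<in> worlds (frame N) \<Longrightarrow> fv A = {} \<Longrightarrow> constants A \<subseteq> K \<Longrightarrow>
      true_at M (i w) A \<longleftrightarrow> true_at N w A"
proof -
  let ?W = "worlds (frame N)" and ?D = "\<Union>w\<in>worlds (frame N). domain (frame N) w"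
  have F: "is_kframe (frame N)" using N by (rule is_kmodel_frame)
  have "finite ?W" "finite ?D"
    using fin by (auto simp: finFin_def Fin_def)
  then obtain i :: "'v \<Rightarrow> 'w" and j :: "'c \<Rightarrow> 'd" where i: "inj_on i ?W" and j: "inj_on j ?D"
    using arb_inj_on_finite_infinite by metis
  define f where "f = inv_into ?W i"
  define h where "h = inv_into ?D j"
  have f: "f (i w) = w" if "w \<in> ?W" for w
    using i that by (simp add: f_def)
  have h: "h (j d) = d" if "d \<in> ?D" for d
    using j that by (simp add: h_def)
  define M :: "('w, 'd, 'p, 'o) kmodel" where
    "M = \<lparr>frame = \<lparr>worlds = i ` ?W, acc = map_prod i i ` acc (frame N),
            domain = (\<lambda>v. j ` domain (frame N) (f v))\<rparr>,
          constI = (\<lambda>c. j (constI N c)),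
          atomI = (\<lambda>v p. map j ` atomI N (f v) p)\<rparr>"
  have W: "worlds (frame M) = i ` ?W"
    and dom: "domain (frame M) v = j ` domain (frame N) (f v)"
    and const: "constI M c = j (constI N c)"
    and atom: "atomI M v p = map j ` atomI N (f v) p" for v c p
    by (simp_all add: M_def)
  have acc: "(i w, v') \<in> acc (frame M) \<longleftrightarrow> (\<exists>v. (w, v) \<in> acc (frame N) \<and> v' = i v)" if "w \<in> ?W" for w v'
  proof -
    have "(i w, v') \<in> acc (frame M) \<longleftrightarrow> (\<exists>w1 v. (w1, v) \<in> acc (frame N) \<and> i w = i w1 \<and> v' = i v)"
      by (auto simp: M_def)
    also have "\<dots> \<longleftrightarrow> (\<exists>v. (w, v) \<in> acc (frame N) \<and> v' = i v)"
      using that i is_kframe_worlds[OF F] by (metis inj_onD)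
    finally show ?thesis .
  qed
  have accW: "acc (frame M) \<subseteq> i ` ?W \<times> i ` ?W"
    using is_kframe_worlds[OF F] by (auto simp: M_def)
  have acc': "(i w, i v) \<in> acc (frame M) \<longleftrightarrow> (w, v) \<in> acc (frame N)" if "w \<in> ?W" "v \<in> ?W" for w v
    using acc[OF that(1)] that i is_kframe_worlds[OF F] by (metis inj_onD)
  have "partial_order_on (i ` ?W) (acc (frame M))"
    unfolding partial_order_on_def preorder_on_def
  proof (intro conjI)
    show "acc (frame M) \<subseteq> i ` ?W \<times> i ` ?W" by (rule accW)
    show "refl_on (i ` ?W) (acc (frame M))"
      using is_kframe_refl[OF F] by (auto simp: refl_on_def acc')
    show "trans (acc (frame M))"
    proof (rule transI)
      fix x y z assume *: "(x, y) \<in> acc (frame M)" "(y, z) \<in> acc (frame M)"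
      then obtain x' y' z' where "x = i x'" "y = i y'" "z = i z'" "x' \<in> ?W" "y' \<in> ?W" "z' \<in> ?W"
        using accW by blast
      with * show "(x, z) \<in> acc (frame M)"
        using is_kframe_trans[OF F] by (metis acc')
    qed
    show "antisym (acc (frame M))"
    proof (rule antisymI)
      fix x y assume *: "(x, y) \<in> acc (frame M)" "(y, x) \<in> acc (frame M)"
      then obtain x' y' where "x = i x'" "y = i y'" "x' \<in> ?W" "y' \<in> ?W"
        using accW by blast
      with * show "x = y"
        using is_kframe_antisym[OF F] by (metis acc')
    qed
  qed
  moreover have mono: "domain (frame M) w \<subseteq> domain (frame M) v" "atomI M w p \<subseteq> atomI M v p"
    if wv: "(w, v) \<in> acc (frame M)" for w v p
  proof -
    obtain w' v' where *: "w = i w'" "v = i v'" "w' \<in> ?W" "v' \<in> ?W"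
      using wv accW by blast
    with wv have "(w', v') \<in> acc (frame N)" by (simp add: acc')
    then have "domain (frame N) w' \<subseteq> domain (frame N) v'" "atomI N w' p \<subseteq> atomI N v' p"
      using is_kmodel_atom_mono[OF N] is_kframe_domain[OF F] by auto
    with * show "domain (frame M) w \<subseteq> domain (frame M) v" "atomI M w p \<subseteq> atomI M v p"
      by (auto simp: dom atom f)
  qed
  ultimately have "is_kframe (frame M)"
    by (auto simp: is_kframe_def W)
  then have "is_kmodel K M"
  proof (rule is_kmodelI)
    show "constI M c \<in> domain (frame M) w" if "c \<in> K" "w \<in> worlds (frame M)" for c w
      using that is_kmodel_const[OF N] by (auto simp: W dom const f)
    show "set ds \<subseteq> domain (frame M) w" if "w \<in> worlds (frame M)" "ds \<in> atomI M w p" for w p ds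
      using that is_kmodel_atom_domain[OF N] by (fastforce simp: W dom atom f)
    show "ds \<in> atomI M v p" if "(w, v) \<in> acc (frame M)" "ds \<in> atomI M w p" for w v p ds
      using mono(2)[OF that(1)] that(2) by blast
  qed
  moreover have "frame M \<in> finFin"
    using fin \<open>is_kframe (frame M)\<close> by (auto simp: finFin_def Fin_def W dom f)
  moreover have "true_at M (i w) A \<longleftrightarrow> true_at N w A"
    if w: "w \<in> ?W" and A: "fv A = {}" "constants A \<subseteq> K" for w A
  proof -
    have hj: "h ` j ` domain (frame N) w = domain (frame N) w" if "w \<in> ?W" for w
      unfolding image_image using that h by (intro trans[OF image_cong image_ident]) auto
    \<comment> \<open>The morphism runs from the copy back to the original: \<open>f\<close> and
      \<open>h\<close> undo the renamings \<open>i\<close> and \<open>j\<close>.\<close>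
    have "forces M (i w) e A \<longleftrightarrow> forces N (f (i w)) (h \<circ> e) A" for e
    proof (rule forces_bounded_morphism[where U = "i ` ?W" and K = K])
      fix w v assume "w \<in> i ` ?W" "(w, v) \<in> acc (frame M)"
      then show "v \<in> i ` ?W \<and> (f w, f v) \<in> acc (frame N)"
        using accW by (auto simp: acc' f)
      show "domain (frame M) w \<subseteq> domain (frame M) v"
        using \<open>(w, v) \<in> acc (frame M)\<close> by (rule mono(1))
    next
      fix w v' assume "w \<in> i ` ?W" "(f w, v') \<in> acc (frame N)"
      then show "\<exists>v. (w, v) \<in> acc (frame M) \<and> f v = v'"
        using is_kframe_worlds[OF F] by (intro exI[of _ "i v'"]) (auto simp: acc' f)
    next
      fix w assume "w \<in> i ` ?W"
      then obtain w' where "w = i w'" "w' \<in> ?W" by auto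
      then show "h ` domain (frame M) w = domain (frame N) (f w)"
        by (simp only: dom f hj)
    next
      fix w p ds assume "w \<in> i ` ?W" and ds: "set ds \<subseteq> domain (frame M) w"
      then obtain w' where w: "w = i w'" "w' \<in> ?W" by auto
      have "map j (map h ds) = ds"
      proof -
        have "j (h d) = d" if "d \<in> set ds" for d
        proof -
          obtain c where "c \<in> domain (frame N) w'" "d = j c"
            using ds \<open>d \<in> set ds\<close> unfolding w(1) dom f[OF w(2)] by blast
          then show ?thesis using h[OF UN_I[OF w(2)]] by simp
        qed
        then show ?thesis by (simp add: map_idI)
      qed
      moreover have "map h (map j cs) = cs" if "cs \<in> atomI N w' p" for cs
      proof -
        have "set cs \<subseteq> ?D"
          using is_kmodel_atom_domain[OF N w(2) that] w(2) by auto
        then show ?thesis using h unfolding map_map by (intro map_idI) (simp add: subset_iff)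
      qed
      ultimately show "ds \<in> atomI M w p \<longleftrightarrow> map h ds \<in> atomI N (f w) p"
        unfolding atom w(1) f[OF w(2)] by (auto intro: image_eqI[where x = "map h ds"])
    next
      fix c assume "c \<in> K"
      then show "h (constI M c) = constI N c"
        using is_kmodel_const[OF N _ w] w by (auto simp: const intro!: h)
    next
      fix c w assume "c \<in> K" "w \<in> i ` ?W"
      then show "constI M c \<in> domain (frame M) w"
        using is_kmodel_const[OF N] by (auto simp: const dom f)
    qed (use w A in auto)
    then show ?thesis
      using f[OF w] true_at_closed[OF A(1)] by metis
  qed
  ultimately show ?thesis
    using that W by blast
qed


section \<open>Truth in a position\<close>

text \<open>The position is read as the world \<open>w\<close>, with \<open>\<Delta>\<close> naming
  all its individuals. Truth in a position and forcing can differ only in two ways: membership in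
  \<open>\<O> \<union> \<P>\<close>, which \<open>complete\<close> supplies for forced formulas, and
  the conditions that implication and the universal quantifier impose at later worlds, which
  \<open>above\<close> supplies for asserted formulas. What remains is the classical reading at
  \<open>w\<close> itself.\<close>

lemma holds_iff_forces:
  assumes F: "is_kframe (frame M)" and w: "w \<in> worlds (frame M)"
    and onto: "constI M ` \<Delta> = domain (frame M) w"
    and atoms: "\<And>p ts. Atom p ts \<in> instances \<Gamma> \<Delta> \<Longrightarrow> Atom p ts \<in> \<O> \<longleftrightarrow> forces M w e (Atom p ts)"
    and complete: "\<And>A. A \<in> instances \<Gamma> \<Delta> \<Longrightarrow> forces M w e A \<Longrightarrow> A \<in> \<O> \<union> \<P>"
    and above: "\<And>A v. A \<in> \<O> \<union> \<P> \<Longrightarrow> (w, v) \<in> acc (frame M) \<Longrightarrow> v \<noteq> w \<Longrightarrow> forces M v e A"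
    and "A \<in> instances \<Gamma> \<Delta>"
  shows "holds (\<O>, \<P>, \<Delta>) A \<longleftrightarrow> forces M w e A"
  using assms(7)
\<comment> \<open>Quantifiers lead to instances of the body, which are not syntactic parts of the
  formula but have smaller depth.\<close>
proof (induction "depth A" arbitrary: A rule: less_induct)
  case less
  have refl: "(w, w) \<in> acc (frame M)"
    using is_kframe_refl[OF F w] .
  have refl': "(v, v) \<in> acc (frame M)" if "(w, v) \<in> acc (frame M)" for v
    using is_kframe_refl[OF F] is_kframe_worlds[OF F that] by blast
  show ?case
  proof (cases A)
    case (Imp B C)
    then have IH: "holds (\<O>, \<P>, \<Delta>) B \<longleftrightarrow> forces M w e B" "holds (\<O>, \<P>, \<Delta>) C \<longleftrightarrow> forces M w e C"
      using less instances_ImpD[of B C] by auto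
    \<comment> \<open>At a world \<open>v\<close> strictly above \<open>w\<close> the whole
      implication is forced by \<open>above\<close>, and reflexivity at \<open>v\<close> yields the
      condition there; at \<open>w\<close> the condition is the second assumption.\<close>
    have "forces M w e A" if "A \<in> \<O> \<union> \<P>" "forces M w e B \<longrightarrow> forces M w e C"
      using that above[OF that(1)] refl' unfolding Imp by (metis forces.simps(3))
    moreover have "forces M w e A \<Longrightarrow> forces M w e B \<longrightarrow> forces M w e C"
      using refl unfolding Imp by simp
    moreover have "holds (\<O>, \<P>, \<Delta>) A \<longleftrightarrow> A \<in> \<O> \<union> \<P> \<and> (forces M w e B \<longrightarrow> forces M w e C)"
      using IH by (simp add: Imp)
    ultimately show ?thesis
      using complete[OF less.prems] by blast
  next
    case (Conj B C)
    then have IH: "holds (\<O>, \<P>, \<Delta>) B \<longleftrightarrow> forces M w e B" "holds (\<O>, \<P>, \<Delta>) C \<longleftrightarrow> forces M w e C"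
      using less instances_ConjD[of B C] by auto
    then show ?thesis
      using complete[OF less.prems] unfolding Conj by auto
  next
    case (Disj B C)
    then have IH: "holds (\<O>, \<P>, \<Delta>) B \<longleftrightarrow> forces M w e B" "holds (\<O>, \<P>, \<Delta>) C \<longleftrightarrow> forces M w e C"
      using less instances_DisjD[of B C] by auto
    then show ?thesis
      using complete[OF less.prems] unfolding Disj by auto
  next
    case (Forall x B)
    have IH: "holds (\<O>, \<P>, \<Delta>) (inst [x \<mapsto> a] B) \<longleftrightarrow> forces M w (e(x := constI M a)) B" if "a \<in> \<Delta>" for a
      using that less instances_ForallD[of x B] Forall by (simp flip: forces_inst_single)
    have "forces M w e A" if "A \<in> \<O> \<union> \<P>" "\<forall>d\<in>domain (frame M) w. forces M w (e(x := d)) B"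
      using that above[OF that(1)] refl' unfolding Forall by (metis forces.simps(6))
    moreover have "forces M w e A \<Longrightarrow> \<forall>d\<in>domain (frame M) w. forces M w (e(x := d)) B"
      using refl unfolding Forall by simp
    moreover have "holds (\<O>, \<P>, \<Delta>) A \<longleftrightarrow>
        A \<in> \<O> \<union> \<P> \<and> (\<forall>d\<in>domain (frame M) w. forces M w (e(x := d)) B)"
      using IH by (simp add: Forall flip: onto)
    ultimately show ?thesis
      using complete[OF less.prems] by blast
  next
    case (Exists x B)
    have IH: "holds (\<O>, \<P>, \<Delta>) (inst [x \<mapsto> a] B) \<longleftrightarrow> forces M w (e(x := constI M a)) B" if "a \<in> \<Delta>" for a
      using that less instances_ExistsD[of x B] Exists by (simp flip: forces_inst_single)
    then have "holds (\<O>, \<P>, \<Delta>) A \<longleftrightarrow> A \<in> \<O> \<union> \<P> \<and> forces M w e A"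
      by (simp add: Exists flip: onto)
    then show ?thesis
      using complete[OF less.prems] by blast
  qed (use atoms less.prems in auto)
qed


text \<open>Either Opponent has a mistake, or the position is the root of a finite model of
  \<open>\<O>\<close>. In the latter case all consequences of \<open>\<O>\<close> are forced at the
  root, hence true in the position, and Proponent has no mistake.\<close>

lemma to_move_consequences:
  fixes \<O> \<P> \<Gamma> :: "('p, 'o) form set"
  assumes fin: "finite \<Gamma>" "finite \<Delta>"
    and K: "(\<Union>B\<in>\<Gamma>. constants B) \<subseteq> \<Delta>"
    and \<O>: "\<O> \<subseteq> instances \<Gamma> \<Delta>"
    and \<P>: "\<P> = {A \<in> instances \<Gamma> \<Delta>.
      entails_over (finFin :: ('w::infinite, 'd::infinite) kframe set) \<Delta> \<O> A}"
  shows "to_move (\<O>, \<P>, \<Delta>) = Opponent"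
proof (cases "mistakes Opponent (\<O>, \<P>, \<Delta>) = {}")
  case False
  then show ?thesis by (simp add: to_move_def)
next
  case True
  define S where "S = instances \<Gamma> \<Delta> - \<P>"
  have "\<exists>(M :: ('w, 'd, 'p, 'o) kmodel) w. is_kmodel \<Delta> M \<and> frame M \<in> finFin \<and>
      (\<forall>B\<in>\<O>. \<forall>w\<in>worlds (frame M). true_at M w B) \<and> w \<in> worlds (frame M) \<and> \<not> true_at M w A"
    if "A \<in> S" for A
    using that by (auto simp: S_def \<P> entails_over_def)
  \<comment> \<open>Packing model and world into a pair lets one application of choice select
    both.\<close>
  then have "\<forall>A\<in>S. \<exists>Mw :: ('w, 'd, 'p, 'o) kmodel \<times> 'w.
      is_kmodel \<Delta> (fst Mw) \<and> frame (fst Mw) \<in> finFin \<and>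
      (\<forall>B\<in>\<O>. \<forall>w\<in>worlds (frame (fst Mw)). true_at (fst Mw) w B) \<and>
      snd Mw \<in> worlds (frame (fst Mw)) \<and> \<not> true_at (fst Mw) (snd Mw) A"
    by simp
  then obtain Mw :: "('p, 'o) form \<Rightarrow> ('w, 'd, 'p, 'o) kmodel \<times> 'w" where
    Mw: "\<forall>A\<in>S. is_kmodel \<Delta> (fst (Mw A)) \<and> frame (fst (Mw A)) \<in> finFin \<and>
      (\<forall>B\<in>\<O>. \<forall>w\<in>worlds (frame (fst (Mw A))). true_at (fst (Mw A)) w B) \<and>
      snd (Mw A) \<in> worlds (frame (fst (Mw A))) \<and> \<not> true_at (fst (Mw A)) (snd (Mw A)) A"
    by (rule bchoice[THEN exE])
  define MM where "MM A = fst (Mw A)" for A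
  define ww where "ww A = snd (Mw A)" for A
  have MM: "is_kmodel \<Delta> (MM A)" "frame (MM A) \<in> finFin"
    and MM_\<O>: "\<And>B w. B \<in> \<O> \<Longrightarrow> w \<in> worlds (frame (MM A)) \<Longrightarrow> true_at (MM A) w B"
    and ww: "ww A \<in> worlds (frame (MM A))" "\<not> true_at (MM A) (ww A) A"
    if "A \<in> S" for A
    using Mw that by (simp_all add: MM_def ww_def)
  have closed: "fv A = {}" "constants A \<subseteq> \<Delta>" if "A \<in> instances \<Gamma> \<Delta>" for A
    using that K by (simp_all add: fv_instances constants_instances)
  have F: "is_kframe (frame (MM A))" if "A \<in> S" for A
    using MM(1)[OF that] by (rule is_kmodel_frame)
  have \<O>\<P>: "\<O> \<subseteq> \<P>"
    using \<O> by (auto simp: \<P> entails_over_refl)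
  have MM_\<P>: "true_at (MM A) w B" if "A \<in> S" "B \<in> \<P>" "w \<in> worlds (frame (MM A))" for A B w
    using that MM MM_\<O> by (auto simp: \<P> entails_over_def)

  \<comment> \<open>\<open>None\<close> is the new root; \<open>Some (A, w)\<close> is the world
    \<open>w\<close> of the model chosen to refute \<open>A\<close>.\<close>
  define W where "W = insert None (Some ` (SIGMA A:S. worlds (frame (MM A))))"
  define R where "R = {(x, y). x = None \<and> y \<in> W} \<union>
    {(Some (A, w), Some (A, v)) | A w v. A \<in> S \<and> (w, v) \<in> acc (frame (MM A))}"
  \<comment> \<open>The objects of \<open>\<Delta>\<close> are individuals of every world, standing
    beside a tagged copy of the original domain. They remain distinct even where \<open>MM A\<close>
    gives two of them the same interpretation.\<close>
  define D :: "(('p, 'o) form \<times> 'w) option \<Rightarrow> ('o + ('p, 'o) form \<times> 'd) set" where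
    "D x = Inl ` \<Delta> \<union>
      (case x of None \<Rightarrow> {} | Some (A, w) \<Rightarrow> (\<lambda>d. Inr (A, d)) ` domain (frame (MM A)) w)" for x
  \<comment> \<open>The collapse onto the individuals of \<open>MM A\<close>: an object goes to its
    interpretation, a tagged copy to its original.\<close>
  define h :: "('p, 'o) form \<Rightarrow> 'o + ('p, 'o) form \<times> 'd \<Rightarrow> 'd" where
    "h A = case_sum (constI (MM A)) snd" for A
  \<comment> \<open>The root has just the atoms of \<open>\<O>\<close>; elsewhere atoms are pulled
    back along \<open>h A\<close>, so that \<open>h A\<close> preserves and reflects them.\<close>
  define I where "I x p =
    (case x of None \<Rightarrow> {map Inl cs | cs. set cs \<subseteq> \<Delta> \<and> Atom p (map Obj cs) \<in> \<O>}
     | Some (A, w) \<Rightarrow> {ds. set ds \<subseteq> D x \<and> map (h A) ds \<in> atomI (MM A) w p})" for x p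
  define N :: "((('p, 'o) form \<times> 'w) option, 'o + ('p, 'o) form \<times> 'd, 'p, 'o) kmodel" where
    "N = \<lparr>frame = \<lparr>worlds = W, acc = R, domain = D\<rparr>, constI = Inl, atomI = I\<rparr>"
  have N_simps: "worlds (frame N) = W" "acc (frame N) = R" "domain (frame N) = D" "constI N = Inl"
    "atomI N = I"
    by (simp_all add: N_def)
  have R_None: "(None, y) \<in> R \<longleftrightarrow> y \<in> W"
    and R_Some: "(Some (A, w), y) \<in> R \<longleftrightarrow> A \<in> S \<and> (\<exists>v. y = Some (A, v) \<and> (w, v) \<in> acc (frame (MM A)))"
    for A w y
    by (auto simp: R_def)
  have W_None: "None \<in> W" and W_Some: "Some (A, w) \<in> W \<longleftrightarrow> A \<in> S \<and> w \<in> worlds (frame (MM A))" for A w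
    by (auto simp: W_def)
  have D_None: "D None = Inl ` \<Delta>"
    and D_Some: "D (Some (A, w)) = Inl ` \<Delta> \<union> (\<lambda>d. Inr (A, d)) ` domain (frame (MM A)) w" for A w
    by (auto simp: D_def)
  have I_Some: "ds \<in> I (Some (A, w)) p \<longleftrightarrow> set ds \<subseteq> D (Some (A, w)) \<and> map (h A) ds \<in> atomI (MM A) w p"
    for ds A w p
    by (simp add: I_def)
  have R_worlds: "x \<in> W \<and> y \<in> W" if "(x, y) \<in> R" for x y
    using that is_kframe_worlds[OF F] by (auto simp: R_def W_None W_Some)

  have "partial_order_on W R"
    unfolding partial_order_on_def preorder_on_def
  proof (intro conjI)
    show "R \<subseteq> W \<times> W" using R_worlds by auto
    show "refl_on W R"
      using is_kframe_refl[OF F] by (auto simp: refl_on_def W_def R_None R_Some)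
    show "trans R"
    proof (rule transI)
      fix x y z assume *: "(x, y) \<in> R" "(y, z) \<in> R"
      show "(x, z) \<in> R"
      proof (cases x)
        case None
        with * R_worlds show ?thesis by (simp add: R_None)
      next
        case (Some a)
        with * is_kframe_trans[OF F] show ?thesis by (cases a) (auto simp: R_Some)
      qed
    qed
    show "antisym R"
    proof (rule antisymI)
      fix x y assume *: "(x, y) \<in> R" "(y, x) \<in> R"
      show "x = y"
      proof (cases x)
        case None
        with *(2) show ?thesis by (cases y) (auto simp: R_Some)
      next
        case (Some a)
        with * is_kframe_antisym[OF F] show ?thesis by (cases a) (auto simp: R_Some)
      qed
    qed
  qed
  moreover have D_mono: "D x \<subseteq> D y" if "(x, y) \<in> R" for x y
  proof (cases x)
    case None
    then show ?thesis by (auto simp: D_def)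
  next
    case (Some a)
    then show ?thesis
      using that is_kframe_domain[OF F] by (cases a) (fastforce simp: R_Some D_Some)
  qed
  ultimately have FN: "is_kframe (frame N)"
    by (auto simp: is_kframe_def N_simps)
  have modN: "is_kmodel \<Delta> N"
  proof (rule is_kmodelI)
    show "constI N c \<in> domain (frame N) x" if "c \<in> \<Delta>" for c x
      using that by (simp add: N_simps D_def)
    show "set ds \<subseteq> domain (frame N) x" if "ds \<in> atomI N x p" for x p ds
      using that by (cases x) (fastforce simp: N_simps I_def D_None)+
    fix x y p ds assume xy: "(x, y) \<in> acc (frame N)" and ds: "ds \<in> atomI N x p"
    show "ds \<in> atomI N y p"
    proof (cases x)
      case None
      then obtain cs where cs: "ds = map Inl cs" "set cs \<subseteq> \<Delta>" "Atom p (map Obj cs) \<in> \<O>"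
        using ds by (auto simp: N_simps I_def)
      show ?thesis
      proof (cases y)
        case None
        with \<open>x = None\<close> ds show ?thesis by simp
      next
        case (Some b)
        then obtain A v where y: "y = Some (A, v)" by (cases b) auto
        then have *: "A \<in> S" "v \<in> worlds (frame (MM A))"
          using xy R_worlds W_Some by (auto simp: N_simps)
        \<comment> \<open>Atoms of the root persist because every chosen model is a model of
          \<open>\<O>\<close>.\<close>
        have "true_at (MM A) v (Atom p (map Obj cs))"
          using MM_\<O>[OF *(1) cs(3) *(2)] .
        then have "map (constI (MM A)) cs \<in> atomI (MM A) v p"
          by (auto simp: true_at_def comp_def)
        then show ?thesis
          using cs(1,2) by (auto simp: y N_simps I_Some D_Some h_def comp_def)
      qed
    next
      case (Some a)
      then obtain A w where x: "x = Some (A, w)" by (cases a) auto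
      with xy obtain v where y: "y = Some (A, v)" and "A \<in> S" "(w, v) \<in> acc (frame (MM A))"
        by (auto simp: N_simps R_Some)
      then have "atomI (MM A) w p \<subseteq> atomI (MM A) v p"
        using is_kmodel_atom_mono[OF MM(1)] by blast
      moreover have "D x \<subseteq> D y"
        using D_mono xy by (simp add: N_simps)
      ultimately show ?thesis
        using ds unfolding N_simps x y I_Some by blast
    qed
  qed (rule FN)
  have "finite S"
    using finite_instances[OF fin] by (simp add: S_def)
  then have finN: "frame N \<in> finFin"
    using FN fin(2) MM(2)
    by (auto simp: finFin_def Fin_def N_simps W_def D_None D_Some intro!: finite_SigmaI)

  \<comment> \<open>Above the root each component keeps its truths: \<open>h A\<close> together with
    forgetting the tag of the world is a bounded morphism onto \<open>MM A\<close>.\<close>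
  have child: "true_at N (Some (A, w)) B \<longleftrightarrow> true_at (MM A) w B"
    if A: "A \<in> S" and w: "w \<in> worlds (frame (MM A))" and B: "fv B = {}" "constants B \<subseteq> \<Delta>" for A w B
  proof -
    let ?U = "Some ` Pair A ` worlds (frame (MM A))"
    \<comment> \<open>The world is written as \<open>snd (the (Some (A, w)))\<close> to have the
      shape \<open>f x\<close> of the morphism rule.\<close>
    have "forces N (Some (A, w)) e B \<longleftrightarrow> forces (MM A) (snd (the (Some (A, w)))) (h A \<circ> e) B" for e
    proof (rule forces_bounded_morphism[where f = "\<lambda>x. snd (the x)" and K = \<Delta> and U = ?U])
      fix x y assume "x \<in> ?U" "(x, y) \<in> acc (frame N)"
      then show "y \<in> ?U \<and> (snd (the x), snd (the y)) \<in> acc (frame (MM A))"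
        using is_kframe_worlds[OF F[OF A]] by (auto simp: N_simps R_Some)
      show "domain (frame N) x \<subseteq> domain (frame N) y"
        using D_mono \<open>(x, y) \<in> acc (frame N)\<close> by (simp add: N_simps)
    next
      fix x v assume "x \<in> ?U" "(snd (the x), v) \<in> acc (frame (MM A))"
      then show "\<exists>y. (x, y) \<in> acc (frame N) \<and> snd (the y) = v"
        using A by (intro exI[of _ "Some (A, v)"]) (auto simp: N_simps R_Some)
    next
      fix x assume "x \<in> ?U"
      then obtain v where x: "x = Some (A, v)" and v: "v \<in> worlds (frame (MM A))" by auto
      have "constI (MM A) ` \<Delta> \<subseteq> domain (frame (MM A)) v"
        using is_kmodel_const[OF MM(1)[OF A] _ v] by auto
      then show "h A ` domain (frame N) x = domain (frame (MM A)) (snd (the x))"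
        by (auto simp: N_simps x D_Some h_def image_Un image_image)
    next
      fix x p ds assume "x \<in> ?U" "set ds \<subseteq> domain (frame N) x"
      then show "ds \<in> atomI N x p \<longleftrightarrow> map (h A) ds \<in> atomI (MM A) (snd (the x)) p"
        by (auto simp: N_simps I_Some)
    next
      fix c assume "c \<in> \<Delta>"
      show "h A (constI N c) = constI (MM A) c"
        by (simp add: N_simps h_def)
    next
      fix c x assume "c \<in> \<Delta>"
      then show "constI N c \<in> domain (frame N) x"
        by (simp add: N_simps D_def)
    qed (use w B in auto)
    then show ?thesis
      using true_at_closed[OF B(1)] by (metis option.sel snd_conv)
  qed
  have above: "true_at N y B"
    if B: "B \<in> \<O> \<union> \<P>" and y_acc: "(None, y) \<in> acc (frame N)" and "y \<noteq> None" for B y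
  proof -
    obtain A w where y: "y = Some (A, w)" using \<open>y \<noteq> None\<close> by (cases y) auto
    have "B \<in> \<P>" using B \<O>\<P> by blast
    moreover have "A \<in> S" "w \<in> worlds (frame (MM A))"
      using y_acc by (simp_all add: y N_simps R_None W_Some)
    ultimately show ?thesis
      using MM_\<P> child closed unfolding y by (simp add: \<P>)
  qed

  \<comment> \<open>All formulas considered are closed, so an arbitrary environment serves
    throughout.\<close>
  fix e :: "nat \<Rightarrow> 'o + ('p, 'o) form \<times> 'd"
  have root: "holds (\<O>, \<P>, \<Delta>) A \<longleftrightarrow> forces N None e A" if "A \<in> instances \<Gamma> \<Delta>" for A
  proof (rule holds_iff_forces[OF FN _ _ _ _ _ that])
    show "None \<in> worlds (frame N)" "constI N ` \<Delta> = domain (frame N) None"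
      by (simp_all add: N_simps W_None D_None)
  next
    fix p ts assume *: "Atom p ts \<in> instances \<Gamma> \<Delta>"
    then obtain cs where ts: "ts = map Obj cs"
      using closed_terms_objects[OF fv_instances] by metis
    moreover have "set cs \<subseteq> \<Delta>"
      using closed(2)[OF *] by (auto simp: ts)
    moreover have "map (val_tm N e) ts = map Inl cs"
      by (simp add: ts N_simps comp_def)
    moreover have "map Inl cs \<in> I None p \<longleftrightarrow> set cs \<subseteq> \<Delta> \<and> Atom p (map Obj cs) \<in> \<O>"
      by (auto simp: I_def inj_map_eq_map)
    ultimately show "Atom p ts \<in> \<O> \<longleftrightarrow> forces N None e (Atom p ts)"
      by (simp only: forces.simps N_simps simp_thms)
  next
    fix B assume B: "B \<in> instances \<Gamma> \<Delta>" "forces N None e B"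
    show "B \<in> \<O> \<union> \<P>"
    proof (rule ccontr)
      assume "B \<notin> \<O> \<union> \<P>"
      then have "B \<in> S" using B(1) by (simp add: S_def)
      \<comment> \<open>Being forced at the root, \<open>B\<close> would persist to the world that
        was chosen to refute it.\<close>
      moreover have "true_at N (Some (B, ww B)) B"
        using forces_mono[OF modN _ B(2), of "Some (B, ww B)"] closed(1)[OF B(1)] ww(1)[OF \<open>B \<in> S\<close>] \<open>B \<in> S\<close>
        by (simp add: true_at_closed[where e = e] N_simps R_None W_Some)
      ultimately show False
        using child ww closed[OF B(1)] by blast
    qed
  next
    fix B y assume *: "B \<in> \<O> \<union> \<P>" "(None, y) \<in> acc (frame N)" "y \<noteq> None"
    then have "fv B = {}" using closed(1) \<O>\<P> by (auto simp: \<P>)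
    then show "forces N y e B"
      using above[OF *] true_at_closed[of B N y e] by blast
  qed
  \<comment> \<open>At the root this is the absence of mistakes of Opponent, read through
    \<open>root\<close>; above the root it is \<open>above\<close>.\<close>
  have "true_at N y B" if "B \<in> \<O>" "y \<in> worlds (frame N)" for B y
  proof (cases "y = None")
    case True
    have "holds (\<O>, \<P>, \<Delta>) B"
      using \<open>mistakes Opponent (\<O>, \<P>, \<Delta>) = {}\<close> that(1) by auto
    moreover have "B \<in> instances \<Gamma> \<Delta>" using \<O> that(1) by blast
    ultimately show ?thesis
      using root[of B] true_at_closed[of B N y e] closed(1)[of B] True by blast
  next
    case False
    then show ?thesis
      using above that by (simp add: N_simps R_None)
  qed
  moreover obtain M :: "('w, 'd, 'p, 'o) kmodel" and i where M: "is_kmodel \<Delta> M" "frame M \<in> finFin"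
    "worlds (frame M) = i ` worlds (frame N)"
    and i: "\<And>w A. w \<in> worlds (frame N) \<Longrightarrow> fv A = {} \<Longrightarrow> constants A \<subseteq> \<Delta> \<Longrightarrow>
      true_at M (i w) A \<longleftrightarrow> true_at N w A"
    by (rule finFin_model_transfer[OF modN finN]) (rule that; blast)
  ultimately have "\<forall>B\<in>\<O>. \<forall>w\<in>worlds (frame M). true_at M w B"
    using closed \<O> by (auto simp: subset_iff)
  with M have "true_at M (i None) A" if "A \<in> \<P>" for A
    using that by (auto simp: \<P> entails_over_def N_simps W_None)
  then have "true_at N None A" if "A \<in> \<P>" for A
    using that i closed by (simp add: \<P> N_simps W_None)
  then have "holds (\<O>, \<P>, \<Delta>) A" if "A \<in> \<P>" for A
    using that root[of A] closed(1)[of A] true_at_closed[of A N None e] by (simp add: \<P>)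
  then show ?thesis
    by (auto simp: to_move_def)
qed


section \<open>Plays\<close>

lemma history_nonempty: "history \<Gamma> C h \<Longrightarrow> h \<noteq> []"
  by (cases rule: history.cases) auto

lemma finished_snoc: "h \<noteq> [] \<Longrightarrow> finished (h @ [C]) \<longleftrightarrow> to_move C = to_move (last h)"
  by (cases h) (auto simp: finished_def)

lemma follows_snoc:
  assumes "h \<noteq> []"
  shows "follows \<sigma> pl (h @ [C]) \<longleftrightarrow> follows \<sigma> pl h \<and> (to_move (last h) = pl \<longrightarrow> C = \<sigma> h)"
proof
  assume *: "follows \<sigma> pl (h @ [C])"
  have "h ! Suc i = \<sigma> (take (Suc i) h)" if "Suc i < length h" "to_move (h ! i) = pl" for i
    using *[unfolded follows_def, rule_format, of i] that by (simp add: nth_append)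
  moreover have "C = \<sigma> h" if "to_move (last h) = pl"
    using *[unfolded follows_def, rule_format, of "length h - 1"] that assms
    by (simp add: nth_append last_conv_nth)
  ultimately show "follows \<sigma> pl h \<and> (to_move (last h) = pl \<longrightarrow> C = \<sigma> h)"
    by (simp add: follows_def)
next
  assume *: "follows \<sigma> pl h \<and> (to_move (last h) = pl \<longrightarrow> C = \<sigma> h)"
  show "follows \<sigma> pl (h @ [C])"
    unfolding follows_def
  proof (intro allI impI, elim conjE)
    fix i assume i: "Suc i < length (h @ [C])" "to_move ((h @ [C]) ! i) = pl"
    show "(h @ [C]) ! Suc i = \<sigma> (take (Suc i) (h @ [C]))"
    proof (cases "Suc i < length h")
      case True
      with * i show ?thesis by (simp add: follows_def nth_append)
    next
      case False
      with i(1) have "Suc i = length h" by simp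
      moreover from this have "i = length h - 1" by simp
      ultimately show ?thesis
        using * i(2) assms by (simp add: nth_append last_conv_nth)
    qed
  qed
qed

text \<open>A reply after which Proponent had to move again would finish the play as a loss, so a
  winning reply hands the turn to Opponent and the play goes on.\<close>

lemma winning_strategy_reply:
  assumes win: "winning_strategy \<Gamma> C\<^sub>0 Proponent \<sigma>"
    and h: "history \<Gamma> C\<^sub>0 h" "\<not> finished h" "follows \<sigma> Proponent h" "to_move (last h) = Proponent"
  shows "legal_move \<Gamma> Proponent (last h) (\<sigma> h)" and "to_move (\<sigma> h) = Opponent"
    and "history \<Gamma> C\<^sub>0 (h @ [\<sigma> h])" and "\<not> finished (h @ [\<sigma> h])"
    and "follows \<sigma> Proponent (h @ [\<sigma> h])"
proof -
  have "h \<noteq> []" using h(1) by (rule history_nonempty)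
  show legal: "legal_move \<Gamma> Proponent (last h) (\<sigma> h)"
    using win h by (simp add: winning_strategy_def)
  show hist: "history \<Gamma> C\<^sub>0 (h @ [\<sigma> h])"
    using history.move[OF h(1,2)] legal h(4) by simp
  show foll: "follows \<sigma> Proponent (h @ [\<sigma> h])"
    using h(3) by (simp add: follows_snoc[OF \<open>h \<noteq> []\<close>])
  show "to_move (\<sigma> h) = Opponent"
  proof (rule ccontr)
    assume "to_move (\<sigma> h) \<noteq> Opponent"
    then have "to_move (\<sigma> h) = Proponent" by (cases "to_move (\<sigma> h)") auto
    then have "is_play \<Gamma> C\<^sub>0 (Finite (h @ [\<sigma> h]))"
      using hist h(4) by (simp add: finished_snoc[OF \<open>h \<noteq> []\<close>])
    then have "winner (Finite (h @ [\<sigma> h])) = Proponent"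
      using win foll unfolding winning_strategy_def by (metis play_follows.simps(1))
    with \<open>to_move (\<sigma> h) = Proponent\<close> show False by simp
  qed
  then show "\<not> finished (h @ [\<sigma> h])"
    using h(4) by (simp add: finished_snoc[OF \<open>h \<noteq> []\<close>])
qed

section \<open>Opponent's play from a finite countermodel\<close>

lemma extend_onto:
  fixes g :: "'o::infinite \<Rightarrow> 'd"
  assumes "finite \<Delta>" and "finite D" and "g ` \<Delta> \<subseteq> D"
  obtains \<Delta>' g' where "\<Delta> \<subseteq> \<Delta>'" and "finite \<Delta>'" and "\<And>c. c \<in> \<Delta> \<Longrightarrow> g' c = g c" and "g' ` \<Delta>' = D"
proof -
  have "infinite (- \<Delta>)"
    using assms(1) infinite_UNIV by (metis finite_compl)
  \<comment> \<open>\<open>E\<close> consists of fresh objects, one for each element of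
    \<open>D\<close>. Individuals that already have a name get a second one.\<close>
  then obtain E where E: "finite E" "card E = card D" "E \<subseteq> - \<Delta>"
    using infinite_arbitrarily_large by blast
  then obtain f where "bij_betw f E D"
    using finite_same_card_bij assms(2) by metis
  then have f: "f ` E = D" by (simp add: bij_betw_def)
  define g' where "g' c = (if c \<in> \<Delta> then g c else f c)" for c
  have "g' ` \<Delta> = g ` \<Delta>" "g' ` E = f ` E"
    using E(3) by (auto simp: g'_def)
  then have "g' ` (\<Delta> \<union> E) = D"
    using assms(3) f by (simp add: image_Un Un_absorb1)
  then show ?thesis
    using that[of "\<Delta> \<union> E" g'] assms(1) E(1) by (simp add: g'_def)
qed

text \<open>Induction on the number of worlds above \<open>w\<close>: each round forces Proponent to
  assert something refuted at a later world, and the frame is finite. The model changes only in its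
  names. Only \<open>is_kmodel {} M\<close> is assumed since the names chosen for \<open>w\<close>
  lie in the domains above \<open>w\<close> but perhaps not in others.\<close>

lemma no_winning_strategy_if_refuted:
  fixes M :: "('w, 'd, 'p, 'o::infinite) kmodel"
  assumes win: "winning_strategy \<Gamma> C\<^sub>0 Proponent \<sigma>"
    and "is_kmodel {} M" and "frame M \<in> finFin" and "w \<in> worlds (frame M)"
    and "history \<Gamma> C\<^sub>0 h" and "\<not> finished h" and "follows \<sigma> Proponent h"
    and "to_move (last h) = Opponent" and "last h = (\<O>, \<P>, \<Delta>)"
    and "finite \<Delta>" and "(\<Union>B\<in>\<Gamma>. constants B) \<subseteq> \<Delta>"
    and "\<O> \<subseteq> instances \<Gamma> \<Delta>" and "\<P> \<subseteq> instances \<Gamma> \<Delta>"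
    and "constI M ` \<Delta> \<subseteq> domain (frame M) w"
    and "\<forall>A\<in>\<O>. forces M w e A" and "\<exists>A\<in>\<P>. \<not> forces M w e A"
  shows False
  using assms(2-)
proof (induction "card {v. (w, v) \<in> acc (frame M)}" arbitrary: M w h \<O> \<P> \<Delta> rule: less_induct)
  case (less M w h \<O> \<P> \<Delta>)
  note M = less.prems(1) and finM = less.prems(2) and w = less.prems(3)
    and h = less.prems(4-8) and fin\<Delta> = less.prems(9) and K = less.prems(10)
    and \<O> = less.prems(11,14) and \<P> = less.prems(12,15) and const = less.prems(13)
  have F: "is_kframe (frame M)" using M by (rule is_kmodel_frame)
  \<comment> \<open>The world \<open>w\<close> is above itself but, by antisymmetry, not above
    \<open>v\<close>.\<close>
  have decrease: "card {u. (v, u) \<in> acc (frame M)} < card {u. (w, u) \<in> acc (frame M)}"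
    if "(w, v) \<in> acc (frame M)" "v \<noteq> w" for v
  proof (rule psubset_card_mono)
    have "{u. (w, u) \<in> acc (frame M)} \<subseteq> worlds (frame M)"
      using is_kframe_worlds[OF F] by auto
    then show "finite {u. (w, u) \<in> acc (frame M)}"
      using finM by (auto simp: finFin_def Fin_def intro: finite_subset)
    show "{u. (v, u) \<in> acc (frame M)} \<subset> {u. (w, u) \<in> acc (frame M)}"
      using that w is_kframe_trans[OF F that(1)] is_kframe_antisym[OF F that(1)] is_kframe_refl[OF F w]
      by blast
  qed
  show False
  \<comment> \<open>In the first case no move is made: the same history is considered at
    \<open>v\<close>. In the second case \<open>w\<close> is maximal among the worlds at or above it
    that refute a formula of \<open>\<P>\<close>, and Opponent moves.\<close>
  proof (cases "\<exists>v. (w, v) \<in> acc (frame M) \<and> v \<noteq> w \<and> (\<exists>A\<in>\<P>. \<not> forces M v e A)")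
    case True
    then obtain v where v: "(w, v) \<in> acc (frame M)" "v \<noteq> w" "\<exists>A\<in>\<P>. \<not> forces M v e A"
      by blast
    have "v \<in> worlds (frame M)" "constI M ` \<Delta> \<subseteq> domain (frame M) v" "\<forall>A\<in>\<O>. forces M v e A"
      using is_kframe_worlds[OF F v(1)] is_kframe_domain[OF F v(1)] const \<O>(2) forces_mono[OF M v(1)]
      by blast+
    then show False
      using less.hyps[OF decrease[OF v(1,2)] M finM _ h fin\<Delta> K \<O>(1) \<P>(1) _ _ v(3)] by blast
  next
    case False
    have "finite (domain (frame M) w)"
      using finM w by (simp add: finFin_def)
    then obtain \<Delta>' g where \<Delta>': "\<Delta> \<subseteq> \<Delta>'" "finite \<Delta>'" and g: "\<And>c. c \<in> \<Delta> \<Longrightarrow> g c = constI M c"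
      and onto: "g ` \<Delta>' = domain (frame M) w"
      using extend_onto[OF fin\<Delta> _ const] by metis
    define M' where "M' = M\<lparr>constI := g\<rparr>"
    have M'_simps: "frame M' = frame M" "constI M' = g" "atomI M' = atomI M"
      by (simp_all add: M'_def)
    have M': "is_kmodel {} M'"
      using M by (simp add: is_kmodel_def M'_simps)
    have same: "forces M' v e A \<longleftrightarrow> forces M v e A" if "A \<in> instances \<Gamma> \<Delta>" for v A
      using forces_cong[of A e e M g v] constants_instances[OF that K] g by (force simp: M'_def)
    have K': "(\<Union>B\<in>\<Gamma>. constants B) \<subseteq> \<Delta>'"
      using K \<Delta>'(1) by (rule subset_trans)
    \<comment> \<open>Opponent asserts everything forced at \<open>w\<close> over the enlarged set
      of names; this includes \<open>\<O>\<close>.\<close>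
    define X where "X = {A \<in> instances \<Gamma> \<Delta>'. forces M' w e A}"
    have \<O>_X: "\<O> \<union> X = X"
      using \<O> same instances_mono[OF \<Delta>'(1), of \<Gamma>] by (auto simp: X_def)
    have \<P>': "\<P> \<subseteq> instances \<Gamma> \<Delta>'"
      using \<P>(1) instances_mono[OF \<Delta>'(1)] by (rule subset_trans)
    have \<P>_refuted: "\<exists>A\<in>\<P>. \<not> forces M' w e A"
      using \<P> same by blast
    \<comment> \<open>Used twice: for \<open>\<P>\<close>, to see that Opponent's move passes the
      turn, and for \<open>\<P>\<close> with Proponent's additions, to see that these must fail
      strictly above \<open>w\<close>.\<close>
    have turn: "to_move (X, \<Q>, \<Delta>') = Proponent"
      if \<Q>: "\<Q> \<subseteq> instances \<Gamma> \<Delta>'" "\<exists>A\<in>\<Q>. \<not> forces M' w e A"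
        and above: "\<And>A v. A \<in> \<Q> \<Longrightarrow> (w, v) \<in> acc (frame M) \<Longrightarrow> v \<noteq> w \<Longrightarrow> forces M' v e A" for \<Q>
    proof -
      have "holds (X, \<Q>, \<Delta>') A \<longleftrightarrow> forces M' w e A" if "A \<in> instances \<Gamma> \<Delta>'" for A
      proof (rule holds_iff_forces[OF _ _ _ _ _ _ that])
        show "is_kframe (frame M')" "w \<in> worlds (frame M')" "constI M' ` \<Delta>' = domain (frame M') w"
          using F w onto by (simp_all add: M'_simps)
        show "forces M' v e B" if "B \<in> X \<union> \<Q>" "(w, v) \<in> acc (frame M')" "v \<noteq> w" for B v
          using that above forces_mono[OF M' that(2)] by (auto simp: X_def M'_simps)
      qed (auto simp: X_def)
      then have "mistakes Opponent (X, \<Q>, \<Delta>') = {}" "mistakes Proponent (X, \<Q>, \<Delta>') \<noteq> {}"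
        using \<Q> by (auto simp: X_def)
      then show ?thesis by (simp add: to_move_def)
    qed
    have "forces M' v e A" if "A \<in> \<P>" "(w, v) \<in> acc (frame M)" "v \<noteq> w" for A v
      using False that same \<P>(1) by blast
    then have C: "to_move (X, \<P>, \<Delta>') = Proponent"
      using turn[OF \<P>' \<P>_refuted] by blast
    have "h \<noteq> []" using h(1) by (rule history_nonempty)
    define h' where "h' = h @ [(X, \<P>, \<Delta>')]"
    have "legal_move \<Gamma> Opponent (last h) (X, \<P>, \<Delta>')"
      using \<Delta>' \<O>_X by (auto simp: h(5) X_def)
    then have h': "history \<Gamma> C\<^sub>0 h'" "\<not> finished h'" "follows \<sigma> Proponent h'" "to_move (last h') = Proponent"
      using history.move[OF h(1,2)] h(3,4) C \<open>h \<noteq> []\<close>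
      by (simp_all add: h'_def finished_snoc follows_snoc)
    note reply = winning_strategy_reply[OF win h']
    obtain Y where Y: "Y \<subseteq> instances \<Gamma> \<Delta>'" and \<sigma>: "\<sigma> h' = (X, \<P> \<union> Y, \<Delta>')"
      using reply(1) by (cases "\<sigma> h'") (auto simp: h'_def)
    have PY: "\<P> \<union> Y \<subseteq> instances \<Gamma> \<Delta>'" using \<P>' Y by simp
    \<comment> \<open>Otherwise \<open>turn\<close> would give Proponent the move again, contrary to
      \<open>reply(2)\<close>.\<close>
    have "\<exists>v. (w, v) \<in> acc (frame M) \<and> v \<noteq> w \<and> (\<exists>A\<in>\<P> \<union> Y. \<not> forces M' v e A)"
      using turn[OF PY] \<P>_refuted reply(2) unfolding \<sigma> by force
    then obtain v where v: "(w, v) \<in> acc (frame M)" "v \<noteq> w" "\<exists>A\<in>\<P> \<union> Y. \<not> forces M' v e A"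
      by blast
    show False
    proof (rule less.hyps[of v M' "h' @ [\<sigma> h']" X "\<P> \<union> Y" \<Delta>'])
      show "card {u. (v, u) \<in> acc (frame M')} < card {u. (w, u) \<in> acc (frame M)}"
        using decrease[OF v(1,2)] by (simp add: M'_simps)
      show "v \<in> worlds (frame M')" "constI M' ` \<Delta>' \<subseteq> domain (frame M') v"
        using is_kframe_worlds[OF F v(1)] is_kframe_domain[OF F v(1)] onto by (auto simp: M'_simps)
      show "\<forall>A\<in>X. forces M' v e A"
        using forces_mono[OF M', of w v] v(1) by (auto simp: X_def M'_simps)
    qed (use M' finM reply \<sigma> \<Delta>' K' PY v(3) in \<open>auto simp: M'_simps X_def\<close>)
  qed
qed

section \<open>Proponent's strategy of asserting all consequences\<close>

lemma consequence_strategy_wins: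
  fixes \<Gamma> :: "('p, 'o) form set"
  assumes \<Gamma>: "finite \<Gamma>" and \<Delta>\<^sub>0: "finite \<Delta>\<^sub>0" "(\<Union>B\<in>\<Gamma>. constants B) \<subseteq> \<Delta>\<^sub>0"
    and start: "\<O>\<^sub>0 \<subseteq> instances \<Gamma> \<Delta>\<^sub>0" "\<P>\<^sub>0 \<subseteq> instances \<Gamma> \<Delta>\<^sub>0"
    and cons: "\<forall>A\<in>\<P>\<^sub>0. entails_over (finFin :: ('w::infinite, 'd::infinite) kframe set) \<Delta>\<^sub>0 \<O>\<^sub>0 A"
    and \<sigma>: "\<And>h \<O> \<P> \<Delta>. last h = (\<O>, \<P>, \<Delta>) \<Longrightarrow> \<sigma> h = (\<O>, \<P> \<union> {A \<in> instances \<Gamma> \<Delta>.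
      entails_over (finFin :: ('w, 'd) kframe set) \<Delta> \<O> A}, \<Delta>)"
  shows "winning_strategy \<Gamma> (\<O>\<^sub>0, \<P>\<^sub>0, \<Delta>\<^sub>0) Proponent \<sigma>"
proof -
  let ?cons = "\<lambda>\<Delta> \<O>. {A \<in> instances \<Gamma> \<Delta>. entails_over (finFin :: ('w, 'd) kframe set) \<Delta> \<O> A}"
  let ?inv = "\<lambda>(\<O>, \<P>, \<Delta>). finite \<Delta> \<and> \<Delta>\<^sub>0 \<subseteq> \<Delta> \<and> \<O> \<subseteq> instances \<Gamma> \<Delta> \<and> \<P> \<subseteq> ?cons \<Delta> \<O>"
  \<comment> \<open>Invariant: all of \<open>\<P>\<close> follows from \<open>\<O>\<close> over
    \<open>\<Delta>\<close>. The second conjunct says that a finished play is lost by Opponent;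
    infinite plays are won by Proponent by definition.\<close>
  have inv: "?inv (last h) \<and> (finished h \<longrightarrow> to_move (last h) = Opponent)"
    if "history \<Gamma> (\<O>\<^sub>0, \<P>\<^sub>0, \<Delta>\<^sub>0) h" "follows \<sigma> Proponent h" for h
    using that
  proof (induction rule: history.induct)
    case start
    then show ?case
      using \<Delta>\<^sub>0 assms(4,5) cons by (auto simp: finished_def)
  next
    case (move h C)
    have "h \<noteq> []" using move.hyps(1) by (rule history_nonempty)
    obtain \<O> \<P> \<Delta> where last: "last h = (\<O>, \<P>, \<Delta>)" by (cases "last h") auto
    have IH: "finite \<Delta>" "\<Delta>\<^sub>0 \<subseteq> \<Delta>" "\<O> \<subseteq> instances \<Gamma> \<Delta>" "\<P> \<subseteq> ?cons \<Delta> \<O>"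
      using move.IH move.prems \<open>h \<noteq> []\<close> by (auto simp: follows_snoc last)
    show ?case
    proof (cases "to_move (last h)")
      case Proponent
      then have "C = \<sigma> h"
        using move.prems \<open>h \<noteq> []\<close> by (simp add: follows_snoc)
      \<comment> \<open>By the invariant the added set already contains \<open>\<P>\<close>, so
        after the move \<open>\<P>\<close> is exactly the set of consequences.\<close>
      also have "\<dots> = (\<O>, ?cons \<Delta> \<O>, \<Delta>)"
        using \<sigma>[OF last] IH(4) by auto
      finally have C: "C = (\<O>, ?cons \<Delta> \<O>, \<Delta>)" .
      have "to_move C = Opponent"
        unfolding C
        by (rule to_move_consequences[OF \<Gamma> IH(1) _ IH(3) refl]) (use \<Delta>\<^sub>0(2) IH(2) in blast)
      then show ?thesis
        using IH C by auto
    next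
      case Opponent
      obtain \<Delta>' X where C: "C = (\<O> \<union> X, \<P>, \<Delta>')" and \<Delta>': "\<Delta> \<subseteq> \<Delta>'" "finite (\<Delta>' - \<Delta>)"
        and X: "X \<subseteq> instances \<Gamma> \<Delta>'"
        using move.hyps(3) Opponent by (cases C) (auto simp: last)
      have "finite \<Delta>'"
        using \<Delta>'(2) IH(1) by simp
      moreover have "?cons \<Delta> \<O> \<subseteq> ?cons \<Delta>' (\<O> \<union> X)"
        using instances_mono[OF \<Delta>'(1)] entails_over_mono[OF _ \<Delta>'(1), of _ \<O> _ "\<O> \<union> X"] by auto
      moreover have "instances \<Gamma> \<Delta> \<subseteq> instances \<Gamma> \<Delta>'"
        using \<Delta>'(1) by (rule instances_mono)
      ultimately have "?inv C"
        unfolding C prod.case using IH X \<Delta>'(1) by blast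
      then show ?thesis
        \<comment> \<open>A play that ends with Opponent's move is finished only if Opponent has to
          move again.\<close>
        using Opponent \<open>h \<noteq> []\<close> by (simp add: finished_snoc)
    qed
  qed
  show ?thesis
    unfolding winning_strategy_def
  proof (intro conjI allI impI)
    fix h :: "('p, 'o) position list"
    obtain \<O> \<P> \<Delta> where last: "last h = (\<O>, \<P>, \<Delta>)" by (cases "last h") auto
    show "legal_move \<Gamma> Proponent (last h) (\<sigma> h)"
      unfolding last \<sigma>[OF last] legal_move.simps
      by (intro conjI refl exI[of _ "?cons \<Delta> \<O>"]) blast
  next
    fix q assume q: "is_play \<Gamma> (\<O>\<^sub>0, \<P>\<^sub>0, \<Delta>\<^sub>0) q \<and> play_follows \<sigma> Proponent q"
    show "winner q = Proponent"
      using q inv by (cases q) auto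
  qed
qed

section \<open>Both directions at the initial position\<close>

theorem theorem5:
  fixes ar :: "'p \<Rightarrow> nat"
    and \<O>\<^sub>0 \<Gamma> :: "('p, 'o::infinite) form set"
    and \<phi> :: "('p, 'o) form"
    and \<Delta>\<^sub>0 :: "'o set"
  assumes "finite \<O>\<^sub>0"
    and "\<forall>\<psi>\<in>\<O>\<^sub>0. sentence ar \<psi>"
    and "sentence ar \<phi>"
    and "\<Gamma> = \<O>\<^sub>0 \<union> {\<phi>}"
    and "\<Delta>\<^sub>0 = (\<Union>\<psi>\<in>\<Gamma>. constants \<psi>)"
  shows "(\<exists>\<sigma>. winning_strategy \<Gamma> (\<O>\<^sub>0, {\<phi>}, \<Delta>\<^sub>0) Proponent \<sigma>) \<longleftrightarrow>
    entails (finFin :: ('w::infinite, 'd::infinite) kframe set) \<O>\<^sub>0 \<phi>"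
proof -
  have closed: "fv A = {}" if "A \<in> \<Gamma>" for A
    using that assms(2-4) by (auto simp: sentence_def)
  then have inst: "\<O>\<^sub>0 \<subseteq> instances \<Gamma> \<Delta>\<^sub>0" "{\<phi>} \<subseteq> instances \<Gamma> \<Delta>\<^sub>0"
    using instances_if_closed[of _ \<Gamma> \<Delta>\<^sub>0] assms(4) by auto
  have fin: "finite \<Gamma>" "finite \<Delta>\<^sub>0"
    using assms(1,4,5) by (auto simp: finite_constants)
  have ent: "entails (finFin :: ('w, 'd) kframe set) \<O>\<^sub>0 \<phi> \<longleftrightarrow>
    entails_over (finFin :: ('w, 'd) kframe set) \<Delta>\<^sub>0 \<O>\<^sub>0 \<phi>"
    by (simp add: entails_iff_entails_over assms(4,5))
  let ?C = "(\<O>\<^sub>0, {\<phi>}, \<Delta>\<^sub>0)"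
  show ?thesis
  proof
    assume "\<exists>\<sigma>. winning_strategy \<Gamma> ?C Proponent \<sigma>"
    then obtain \<sigma> where win: "winning_strategy \<Gamma> ?C Proponent \<sigma>" ..
    show "entails (finFin :: ('w, 'd) kframe set) \<O>\<^sub>0 \<phi>"
    proof (rule ccontr)
      assume "\<not> entails (finFin :: ('w, 'd) kframe set) \<O>\<^sub>0 \<phi>"
      then obtain M :: "('w, 'd, 'p, 'o) kmodel" and w where M: "is_kmodel \<Delta>\<^sub>0 M" "frame M \<in> finFin"
        and w: "w \<in> worlds (frame M)"
        and \<O>\<^sub>0: "\<forall>B\<in>\<O>\<^sub>0. \<forall>w\<in>worlds (frame M). true_at M w B" and \<phi>: "\<not> true_at M w \<phi>"
        unfolding ent entails_over_def by blast
      fix e :: "nat \<Rightarrow> 'd"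
      have forced: "\<forall>B\<in>\<O>\<^sub>0. forces M w e B" and refuted: "\<not> forces M w e \<phi>"
        using \<O>\<^sub>0 \<phi> w closed true_at_closed[of _ M w e] unfolding assms(4) by blast+
      have M': "is_kmodel {} M" using M(1) by (rule is_kmodel_antimono) simp
      have const: "constI M ` \<Delta>\<^sub>0 \<subseteq> domain (frame M) w"
        using is_kmodel_const[OF M(1) _ w] by auto
      have K: "(\<Union>B\<in>\<Gamma>. constants B) \<subseteq> \<Delta>\<^sub>0" by (simp add: assms(5))
      have h: "history \<Gamma> ?C [?C]" "\<not> finished [?C]" "follows \<sigma> Proponent [?C]"
        by (auto simp: finished_def follows_def intro: history.start)
      show False
      \<comment> \<open>The refutation argument starts with Opponent to move. If Proponent begins,
        one reply of the strategy leads there and keeps \<open>\<phi>\<close> among the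
        assertions.\<close>
      proof (cases "to_move ?C")
        case Opponent
        then show False
          using no_winning_strategy_if_refuted[OF win M' M(2) w h _ _ fin(2) K inst const forced] refuted
          by simp
      next
        case Proponent
        then have turn: "to_move (last [?C]) = Proponent" by simp
        note reply = winning_strategy_reply[OF win h turn]
        obtain Y where Y: "Y \<subseteq> instances \<Gamma> \<Delta>\<^sub>0" and \<sigma>: "\<sigma> [?C] = (\<O>\<^sub>0, {\<phi>} \<union> Y, \<Delta>\<^sub>0)"
          using reply(1) by (cases "\<sigma> [?C]") auto
        have PY: "{\<phi>} \<union> Y \<subseteq> instances \<Gamma> \<Delta>\<^sub>0" using inst(2) Y by simp
        show False
          using no_winning_strategy_if_refuted[OF win M' M(2) w reply(3-5) _ _ fin(2) K inst(1) PY const forced]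
            reply(2) \<sigma> refuted by auto
      qed
    qed
  next
    assume "entails (finFin :: ('w, 'd) kframe set) \<O>\<^sub>0 \<phi>"
    then have "\<forall>A\<in>{\<phi>}. entails_over (finFin :: ('w, 'd) kframe set) \<Delta>\<^sub>0 \<O>\<^sub>0 A"
      by (simp add: ent)
    moreover define \<sigma> :: "('p, 'o) strategy" where "\<sigma> h = (case last h of (\<O>, \<P>, \<Delta>) \<Rightarrow>
      (\<O>, \<P> \<union> {A \<in> instances \<Gamma> \<Delta>. entails_over (finFin :: ('w, 'd) kframe set) \<Delta> \<O> A}, \<Delta>))" for h
    ultimately have "winning_strategy \<Gamma> ?C Proponent \<sigma>"
      using assms(5) by (intro consequence_strategy_wins[OF fin _ inst]) simp_all
    then show "\<exists>\<sigma>. winning_strategy \<Gamma> ?C Proponent \<sigma>"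
      by blast
  qed
qed

end
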